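(* Let $(w_n)_{n\ge 0}$ and $(v_k)_{k\ge 1}$ be sequences of nonnegative reals with $W(z)=\sum_{n\ge0}w_nz^n$, and assume there are $\rho_w>0$, $\alpha>-1$ and slowly varying $L_w,L_v$ with $$w_n\sim L_w(n)\,n^{-1}\rho_w^{-n},\qquad W(\rho_w)\in(0,\infty),\qquad v_n\sim L_v(n)\,n^{\alpha-1}W(\rho_w)^{-n}.$$ Let $X$ have probability generating function $W(\rho_w z)/W(\rho_w)$. Let $(K_1,\dots,K_{N_n})$ follow the Gibbs partition model $\mathbb{P}_n$, and let $\tilde X_1,\tilde X_2,\dots$ be i.i.d. copies of $(X\mid X\le n)$, independent of $N_n$. Then, as $n\to\infty$, $$d_{\mathrm{TV}}\Big(\mathcal{L}\big(\tau(K_1,\dots,K_{N_n})\big),\ \mathcal{L}\big(\tilde X_1,\dots,\tilde X_{N_n-1}\big)\Big)\to0.$$ Consequently, if $K_{(1)}\ge K_{(2)}\ge\cdots$ denote the components ordered decreasingly, then $K_{(1)}/n\to1$ in probability and $K_{(2)}=o_p(n)$ (i.e. $K_{(2)}/n\to 0$ in probability).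
   Context: For $k\ge1$ set $w_n^{(k)}=\sum_{n_1+\dots+n_k=n,\ n_i\ge0}\prod_{i=1}^k w_{n_i}$ and $u_n=\sum_{k\ge1}v_k w_n^{(k)}$. For $n$ with $0<u_n<\infty$, the Gibbs partition model is the probability measure on finite sequences $(n_1,\dots,n_k)$ ($k\ge1$) of nonnegative integers summing to $n$ given by $\mathbb{P}_n(n_1,\dots,n_k)=v_k\prod_{i=1}^k w_{n_i}/u_n$; $(K_1,\dots,K_{N_n})$ denotes a random sequence with this law. The "delete first maximum" operator $\tau:\bigcup_{k\ge1}\mathbb{N}_0^k\to\bigcup_{k\ge0}\mathbb{N}_0^k$ maps $(x_1,\dots,x_k)$ to $(x_1,\dots,x_{J-1},x_{J+1},\dots,x_k)$ where $J=\min\{j: x_j=\max_i x_i\}$. $d_{\mathrm{TV}}$ is total variation distance on laws of finite sequences. *)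

theory Defs
  imports "HOL-Probability.Probability" "HOL-Library.Landau_Symbols"
begin

definition slowly_varying :: "(real \<Rightarrow> real) \<Rightarrow> bool" where
  "slowly_varying L \<longleftrightarrow> L \<in> borel_measurable borel \<and>
     (\<forall>\<^sub>F x in at_top. L x > 0) \<and>
     (\<forall>c>0. ((\<lambda>x. L (c * x) / L x) \<longlongrightarrow> 1) at_top)"

definition comps :: "nat \<Rightarrow> nat \<Rightarrow> nat list set" where
  "comps k n = {xs. length xs = k \<and> sum_list xs = n}"

definition wconv :: "(nat \<Rightarrow> real) \<Rightarrow> nat \<Rightarrow> nat \<Rightarrow> real" where
  "wconv w k n = (\<Sum>xs\<in>comps k n. prod_list (map w xs))"

definition gibbs_u :: "(nat \<Rightarrow> real) \<Rightarrow> (nat \<Rightarrow> real) \<Rightarrow> nat \<Rightarrow> ennreal" where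
  "gibbs_u v w n = (\<Sum>k. ennreal (v (Suc k) * wconv w (Suc k) n))"

text \<open>The Gibbs partition model P_n on finite sequences (meaningful when 0 < u_n < infinity).\<close>
definition gibbs_pmf :: "(nat \<Rightarrow> real) \<Rightarrow> (nat \<Rightarrow> real) \<Rightarrow> nat \<Rightarrow> nat list pmf" where
  "gibbs_pmf v w n = embed_pmf (\<lambda>xs. if xs \<noteq> [] \<and> sum_list xs = n
      then v (length xs) * prod_list (map w xs) / enn2real (gibbs_u v w n) else 0)"

definition tau :: "nat list \<Rightarrow> nat list" where
  "tau xs = remove1 (Max (set xs)) xs"

definition largest :: "nat list \<Rightarrow> nat" where
  "largest xs = (if xs = [] then 0 else Max (set xs))"

definition second_largest :: "nat list \<Rightarrow> nat" where
  "second_largest xs = largest (tau xs)"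

text \<open>Law of X with generating function W(rho z)/W(rho).\<close>
definition X_pmf :: "(nat \<Rightarrow> real) \<Rightarrow> real \<Rightarrow> nat pmf" where
  "X_pmf w \<rho> = embed_pmf (\<lambda>m. w m * \<rho> ^ m / (\<Sum>j. w j * \<rho> ^ j))"

definition tv_dist :: "'a pmf \<Rightarrow> 'a pmf \<Rightarrow> real" where
  "tv_dist p q = (SUP A. \<bar>measure_pmf.prob p A - measure_pmf.prob q A\<bar>)"

end

theory Submission
  imports Defs "HOL-Real_Asymp.Real_Asymp" "HOL-Computational_Algebra.Formal_Power_Series"
begin

text \<open>
  After an exponential tilt, \<open>w\<close> becomes the law \<open>p\<close> of \<open>X\<close> with \<open>l\<^sub>n = n p\<^sub>n\<close> slowly varying, and
  \<open>v\<close> becomes a regularly varying sequence \<open>q\<close>. Put \<open>b\<^sub>m = (m + 1) q\<^sub>m\<^sub>+\<^sub>1\<close>, \<open>F\<^sub>n = P(X \<le> n)\<close> and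
  \<open>A\<^sub>n = \<Sum>\<^sub>m b\<^sub>m F\<^sub>n\<^sup>m\<close>. The reference law \<open>M\<^sub>n\<close> on sequences has \<open>m\<close> entries with probability
  \<open>b\<^sub>m F\<^sub>n\<^sup>m / A\<^sub>n\<close>, which are independent copies of \<open>X\<close> conditioned on \<open>X \<le> n\<close>. A sequence with sum
  \<open>s < n/2\<close> has \<open>m + 1\<close> preimages under \<open>\<tau>\<close>, obtained by inserting \<open>n - s\<close>; since \<open>l\<close> hardly varies
  on \<open>[n/2, n]\<close>, its probability under the law of \<open>\<tau>(K)\<close> is at least \<open>(1 - o(1)) p\<^sub>n A\<^sub>n / u\<^sub>n\<close> times
  its \<open>M\<^sub>n\<close>-probability. As both laws have mass one, two estimates suffice: \<open>u\<^sub>n \<le> (1 + o(1)) p\<^sub>n A\<^sub>n\<close>,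
  and that the sum is \<open>o(n)\<close> in \<open>M\<^sub>n\<close>-mean.

  The first comes from applying the size-biasing identity
  \<open>n P(S\<^sub>k = n) = k \<Sum>\<^sub>i l\<^sub>i P(S\<^sub>k\<^sub>-\<^sub>1 = n - i)\<close> twice. Both errors are of relative order
  \<open>l\<^sub>n B\<^sub>n / A\<^sub>n\<close> with \<open>B\<^sub>n = \<Sum>\<^sub>m m b\<^sub>m F\<^sub>n\<^sup>m\<^sup>-\<^sup>1\<close>, and this tends to 0 because \<open>B\<^sub>n = O(A\<^sub>n / (1 - F\<^sub>n))\<close> by
  doubling of \<open>b\<close> while \<open>l\<^sub>n = o(1 - F\<^sub>n)\<close> by slow variation.
\<close>

section \<open>Uniform convergence for slowly varying functions\<close>

text \<open>The deviation at a single \<open>u\<close> is controlled by its averages \<open>D t\<close> and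
  \<open>D (t + u)\<close> over an interval, and these tend to 0 by dominated convergence.\<close>

lemma additive_uniform_convergence:
  fixes h :: "real \<Rightarrow> real"
  assumes h[measurable]: "h \<in> borel_measurable borel"
    and lim: "\<And>u. ((\<lambda>t. h (t + u) - h t) \<longlongrightarrow> 0) at_top"
    and "\<epsilon> > 0"
  shows "\<forall>\<^sub>F t in at_top. \<forall>u\<in>{0..1}. \<bar>h (t + u) - h t\<bar> < \<epsilon>"
proof -
  \<comment> \<open>Truncation at 1 supplies the integrable bound for dominated convergence.\<close>
  define g where "g t u = min 1 \<bar>h (t + u) - h t\<bar>" for t u
  define D where "D t = (\<integral>u. g t u * indicator {0..2} u \<partial>lborel)" for t
  have g01: "0 \<le> g t u" "g t u \<le> 1" for t u by (auto simp: g_def)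
  have meas[measurable]: "(\<lambda>u. g t u) \<in> borel_measurable borel" for t
    unfolding g_def by measurable
  have D_lim: "(D \<longlongrightarrow> (\<integral>u. 0 \<partial>(lborel :: real measure))) at_top"
    unfolding D_def
  proof (rule integral_dominated_convergence_at_top[where w = "\<lambda>u. indicator {0..2} u"])
    show "AE u in lborel. ((\<lambda>t. g t u * indicator {0..2} u) \<longlongrightarrow> 0) at_top"
    proof (intro AE_I2)
      fix u :: real
      have "((\<lambda>t. min 1 \<bar>h (t + u) - h t\<bar> * indicator {0..2} u) \<longlongrightarrow> min 1 \<bar>0\<bar> * indicator {0..2} u) at_top"
        by (intro tendsto_intros lim)
      then show "((\<lambda>t. g t u * indicator {0..2} u) \<longlongrightarrow> 0) at_top"
        by (simp add: g_def)
    qed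
    show "\<forall>\<^sub>F t in at_top. AE u in lborel. norm (g t u * indicator {0..2} u) \<le> indicator {0..2} u"
      using g01 by (intro always_eventually allI AE_I2) (auto simp: indicator_def)
  qed auto
  \<comment> \<open>Since 2 * e < 1, a bound by 2 * e on the truncated increment bounds the
    increment itself.\<close>
  define e where "e = min 1 \<epsilon> / 3"
  have e: "0 < e" "2 * e < 1" "2 * e < \<epsilon>" using \<open>\<epsilon> > 0\<close> by (auto simp: e_def min_def)
  have "\<forall>\<^sub>F t in at_top. D t < e"
    using D_lim e by (intro order_tendstoD(2)) auto
  then obtain T where T: "\<And>t. t \<ge> T \<Longrightarrow> D t < e"
    by (auto simp: eventually_at_top_linorder)
  have "\<bar>h (t + u) - h t\<bar> < \<epsilon>" if t: "t \<ge> T" and u: "u \<in> {0..1}" for t u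
  proof -
    have int: "integrable lborel (\<lambda>s. g t s * indicator {0..2} s)" for t
      using g01
      by (intro Bochner_Integration.integrable_bound[OF integrable_real_indicator[of "{0..2}" lborel]])
         (auto simp: indicator_def)
    have int2: "integrable lborel (\<lambda>s. g (t + u) (s - u) * indicator {0..2} (s - u))"
      using lborel_integrable_real_affine[OF int[of "t+u"], of 1 "-u"] by simp
    have shift: "(\<integral>s. g (t + u) (s - u) * indicator {0..2} (s - u) \<partial>lborel) = D (t + u)"
      unfolding D_def using lborel_integral_real_affine[of 1 "\<lambda>s. g (t + u) s * indicator {0..2} s" "-u"] by simp
    \<comment> \<open>For s in [1, 2] both s and s - u lie in [0, 2], and the triangle inequality
      can pass through h (t + s) = h ((t + u) + (s - u)).\<close>
    have "g t u = (\<integral>s. g t u * indicator {1..2} s \<partial>(lborel :: real measure))"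
      by simp
    also have "\<dots> \<le> (\<integral>s. g t s * indicator {0..2} s + g (t + u) (s - u) * indicator {0..2} (s - u) \<partial>lborel)"
    proof (rule integral_mono)
      show "integrable lborel (\<lambda>s. g t s * indicator {0..2} s + g (t + u) (s - u) * indicator {0..2} (s - u))"
        using int int2 by auto
      show "integrable lborel (\<lambda>s :: real. g t u * indicator {1..2} s)"
        by (intro integrable_mult_right integrable_real_indicator) auto
      fix s :: real
      have "g t u \<le> g t s + g (t + u) (s - u)" by (auto simp: g_def min_def)
      then show "g t u * indicator {1..2} s \<le> g t s * indicator {0..2} s + g (t + u) (s - u) * indicator {0..2} (s - u)"
        using u g01 by (auto simp: indicator_def)
    qed
    also have "\<dots> = D t + D (t + u)"
      using int int2 shift by (simp add: D_def)
    also have "\<dots> < 2 * e" using T[of t] T[of "t + u"] t u by auto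
    finally show ?thesis using e by (auto simp: g_def min_def split: if_splits)
  qed
  then show ?thesis unfolding eventually_at_top_linorder by blast
qed

text \<open>With x = exp t, ratios of \<open>L\<close> become increments of
  \<open>ln (L (exp t))\<close>, and y in [x, 2x] becomes a shift in [0, ln 2], hence in [0, 1],
  where the additive result applies.\<close>

lemma slowly_varying_uniform_convergence:
  assumes L: "slowly_varying L" and "\<epsilon> > 0"
  shows "\<forall>\<^sub>F x in at_top. \<forall>y\<in>{x..2*x}. 0 < L x \<and> 0 < L y \<and> \<bar>L y / L x - 1\<bar> < \<epsilon>"
proof -
  have [measurable]: "L \<in> borel_measurable borel" 
    and pos: "\<forall>\<^sub>F x in at_top. L x > 0"
    and lim: "\<And>c. c > 0 \<Longrightarrow> ((\<lambda>x. L (c * x) / L x) \<longlongrightarrow> 1) at_top"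
    using L by (auto simp: slowly_varying_def)
  define h where "h t = ln (L (exp t))" for t
  have h: "h \<in> borel_measurable borel" unfolding h_def by measurable
  have pos_exp: "\<forall>\<^sub>F t in at_top. L (exp (t + u)) > 0" for u
    by (rule eventually_compose_filterlim[OF pos]) real_asymp
  have "((\<lambda>t. h (t + u) - h t) \<longlongrightarrow> 0) at_top" for u
  proof -
    have "((\<lambda>t. L (exp u * exp t) / L (exp t)) \<longlongrightarrow> 1) at_top"
      by (rule filterlim_compose[OF lim]) (auto intro: exp_at_top)
    then have "((\<lambda>t. ln (L (exp u * exp t) / L (exp t))) \<longlongrightarrow> ln 1) at_top"
      by (intro tendsto_ln) auto
    moreover have "\<forall>\<^sub>F t in at_top. ln (L (exp u * exp t) / L (exp t)) = h (t + u) - h t"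
      using pos_exp[of u] pos_exp[of 0]
      by eventually_elim (simp add: h_def ln_div exp_add mult.commute)
    ultimately show ?thesis by (simp add: filterlim_cong)
  qed
  note lim_h = this
  have "\<exists>d>0. \<forall>r. \<bar>r\<bar> < d \<longrightarrow> \<bar>exp r - 1 :: real\<bar> < \<epsilon>"
  proof -
    have "isCont exp (0::real)" by simp
    then show ?thesis
      using \<open>\<epsilon> > 0\<close> unfolding continuous_at_eps_delta by (auto simp: dist_real_def)
  qed
  then obtain d where d: "d > 0" "\<And>r. \<bar>r\<bar> < d \<Longrightarrow> \<bar>exp r - 1 :: real\<bar> < \<epsilon>" by blast
  from pos obtain X where X: "\<And>x. x \<ge> X \<Longrightarrow> L x > 0" by (auto simp: eventually_at_top_linorder)
  have "\<forall>\<^sub>F x in at_top. \<forall>u\<in>{0..1}. \<bar>h (ln x + u) - h (ln x)\<bar> < d"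
    using additive_uniform_convergence[OF h lim_h d(1)] ln_at_top by (rule eventually_compose_filterlim)
  with eventually_ge_at_top[of X] eventually_gt_at_top[of 0] show ?thesis
  proof eventually_elim
    case (elim x)
    show ?case
    proof safe
      fix y assume y: "y \<in> {x..2*x}"
      show p: "L x > 0" "L y > 0" using y elim X[of x] X[of y] by auto
      have "ln (2 :: real) \<le> 1" using ln_2_less_1 by simp
      moreover have "ln y \<le> ln (2 * x)" using y elim by auto
      moreover have "ln (2 * x) = ln 2 + ln x" using elim by (simp add: ln_mult)
      ultimately have "ln y - ln x \<in> {0..1}" using y elim by auto
      then have "\<bar>h (ln x + (ln y - ln x)) - h (ln x)\<bar> < d" using elim by blast
      then have "\<bar>h (ln y) - h (ln x)\<bar> < d" by simp
      moreover have "h (ln y) - h (ln x) = ln (L y / L x)" using p y elim by (simp add: h_def ln_div)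
      ultimately show "\<bar>L y / L x - 1\<bar> < \<epsilon>" using d(2)[of "ln (L y / L x)"] p by simp
    qed
  qed
qed

text \<open>The form of slow variation used from here on: flatness on dyadic windows, stated without
  quotients and in both directions. Longer ranges are reached by iterated doubling.\<close>

definition slow_seq :: "(nat \<Rightarrow> real) \<Rightarrow> bool" where
  "slow_seq f \<longleftrightarrow> (\<forall>\<epsilon>>0. \<forall>\<^sub>F m in sequentially. \<forall>n\<in>{m..2*m}. 0 < f m \<and> 0 < f n \<and>
     f m \<le> (1 + \<epsilon>) * f n \<and> f n \<le> (1 + \<epsilon>) * f m)"

lemma slow_seq_of_slowly_varying:
  assumes L: "slowly_varying L" and c: "c > 0"
    and f: "f \<sim>[at_top] (\<lambda>n. c * L (real n))"
  shows "slow_seq f"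
  unfolding slow_seq_def
proof (intro allI impI)
  fix \<epsilon> :: real assume "\<epsilon> > 0"
  \<comment> \<open>Three relative errors of size e accumulate: f m against L m, L m against L n,
    and L n against f n. The factor 16 gives the room needed in the inequalities \<open>a\<close>
    and \<open>b\<close>.\<close>
  define e where "e = min 1 \<epsilon> / 16"
  have e: "0 < e" "e \<le> 1/16" "16 * e \<le> \<epsilon>" using \<open>\<epsilon> > 0\<close> by (auto simp: e_def)
  have "\<forall>\<^sub>F x in at_top. \<forall>y\<in>{x..2*x}. 0 < L x \<and> 0 < L y \<and> \<bar>L y / L x - 1\<bar> < e"
    by (rule slowly_varying_uniform_convergence[OF L e(1)])
  then have ev1: "\<forall>\<^sub>F m in sequentially. \<forall>y\<in>{real m..2*real m}. 0 < L m \<and> 0 < L y \<and> \<bar>L y / L m - 1\<bar> < e"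
    by (rule eventually_compose_filterlim) (rule filterlim_real_sequentially)
  \<comment> \<open>Asymptotic equivalence counts 0 / 0 as 1; positivity of \<open>L\<close>
    excludes that case further down.\<close>
  have "((\<lambda>n. if f n = 0 \<and> c * L (real n) = 0 then 1 else f n / (c * L (real n))) \<longlongrightarrow> 1) at_top"
    using f by (simp add: asymp_equiv_def)
  then have "\<forall>\<^sub>F n in sequentially. dist (if f n = 0 \<and> c * L (real n) = 0 then 1 else f n / (c * L (real n))) 1 < e"
    by (rule tendstoD) (rule e)
  then obtain N where N: "\<And>n. n \<ge> N \<Longrightarrow> \<bar>(if f n = 0 \<and> c * L (real n) = 0 then 1 else f n / (c * L (real n))) - 1\<bar> < e"
    by (auto simp: eventually_sequentially dist_real_def)
  show "\<forall>\<^sub>F m in sequentially. \<forall>n\<in>{m..2*m}. 0 < f m \<and> 0 < f n \<and> f m \<le> (1 + \<epsilon>) * f n \<and> f n \<le> (1 + \<epsilon>) * f m"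
    using ev1 eventually_ge_at_top[of N]
  proof eventually_elim
    case (elim m)
    show ?case
    proof
      fix n assume n: "n \<in> {m..2*m}"
      then have "real n \<in> {real m..2*real m}" by auto
      with elim have L': "0 < L m" "0 < L n" "\<bar>L n / L m - 1\<bar> < e" by blast+
      define x y where "x = c * L m" and "y = c * L n"
      have xy: "x > 0" "y > 0" "\<bar>y / x - 1\<bar> < e" using L' c by (auto simp: x_def y_def)
      have "\<bar>(if f m = 0 \<and> x = 0 then 1 else f m / x) - 1\<bar> < e"
        "\<bar>(if f n = 0 \<and> y = 0 then 1 else f n / y) - 1\<bar> < e"
        using N[of m] N[of n] \<open>N \<le> m\<close> n unfolding x_def y_def by (meson atLeastAtMost_iff le_trans)+
      then have "\<bar>f m / x - 1\<bar> < e" "\<bar>f n / y - 1\<bar> < e" using xy by simp_all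
      then have fm: "(1-e)*x < f m" "f m < (1+e)*x" and fn: "(1-e)*y < f n" "f n < (1+e)*y"
        and yx: "(1-e)*x < y" "y < (1+e)*x"
        using xy by (auto simp: abs_less_iff field_simps)
      have "0 < (1-e)*x" "0 < (1-e)*y" using e xy by auto
      then have pos: "0 < f m" "0 < f n" using fm fn by linarith+
      have a: "(1 + e) \<le> (1 + \<epsilon>) * (1 - e) * (1 - e)"
      proof -
        have "(1 + e) \<le> (1 + 16 * e) * ((1 - e) * (1 - e))"
        proof -
          have "(1 + 16 * e) * ((1 - e) * (1 - e)) - (1 + e) = e * (13 - 31 * e + 16 * e * e)"
            by algebra
          also have "\<dots> \<ge> 0" using e by (intro mult_nonneg_nonneg add_nonneg_nonneg) auto
          finally show ?thesis by simp
        qed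
        also have "\<dots> \<le> (1 + \<epsilon>) * ((1 - e) * (1 - e))" using e by (intro mult_right_mono) auto
        finally show ?thesis by (simp add: mult.assoc)
      qed
      have b: "(1 + e) * (1 + e) \<le> (1 + \<epsilon>) * (1 - e)"
      proof -
        have "(1 + 16 * e) * (1 - e) - (1 + e) * (1 + e) = e * (13 - 17 * e)" by algebra
        also have "\<dots> \<ge> 0" using e by (intro mult_nonneg_nonneg) auto
        finally have "(1 + e) * (1 + e) \<le> (1 + 16 * e) * (1 - e)" by simp
        also have "\<dots> \<le> (1 + \<epsilon>) * (1 - e)" using e by (intro mult_right_mono) auto
        finally show ?thesis .
      qed
      have "f m \<le> (1+e)*x" using fm by simp
      also have "\<dots> \<le> (1 + \<epsilon>) * (1 - e) * (1 - e) * x" using a xy by (intro mult_right_mono) auto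
      also have "\<dots> = ((1 + \<epsilon>) * (1 - e)) * ((1 - e) * x)" by (simp add: mult_ac)
      also have "\<dots> \<le> ((1 + \<epsilon>) * (1 - e)) * y" using yx e \<open>\<epsilon>>0\<close> by (intro mult_left_mono) auto
      also have "\<dots> = (1 + \<epsilon>) * ((1 - e) * y)" by (simp add: mult_ac)
      also have "\<dots> \<le> (1 + \<epsilon>) * f n" using fn \<open>\<epsilon>>0\<close> by (intro mult_left_mono) auto
      finally have 1: "f m \<le> (1 + \<epsilon>) * f n" .
      have "f n \<le> (1+e)*y" using fn by simp
      also have "\<dots> \<le> (1+e)*((1+e)*x)" using yx e by (intro mult_left_mono) auto
      also have "\<dots> = ((1+e)*(1+e))*x" by simp
      also have "\<dots> \<le> ((1 + \<epsilon>) * (1 - e)) * x" using b xy by (intro mult_right_mono) auto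
      also have "\<dots> = (1 + \<epsilon>) * ((1 - e) * x)" by simp
      also have "\<dots> \<le> (1 + \<epsilon>) * f m" using fm \<open>\<epsilon>>0\<close> by (intro mult_left_mono) auto
      finally have 2: "f n \<le> (1 + \<epsilon>) * f m" .
      show "0 < f m \<and> 0 < f n \<and> f m \<le> (1 + \<epsilon>) * f n \<and> f n \<le> (1 + \<epsilon>) * f m"
        using pos 1 2 by simp
    qed
  qed
qed

section \<open>Slowly varying sequences\<close>

lemma sum_inverse_sqrt_le: "(\<Sum>r=1..n. 1 / sqrt (real r)) \<le> 2 * sqrt (real n)"
proof (induction n)
  case (Suc n)
  have "1 / sqrt (Suc n) \<le> 2 * (sqrt (Suc n) - sqrt n)"
  proof -
    have "2 * (sqrt (Suc n) - sqrt n) * sqrt (Suc n) - 1 = (sqrt (Suc n) - sqrt n)^2"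
      by (simp add: power2_diff algebra_simps)
    then have "1 \<le> 2 * (sqrt (Suc n) - sqrt n) * sqrt (Suc n)"
      by (smt (verit) zero_le_power2)
    then show ?thesis by (simp add: divide_le_eq)
  qed
  then show ?case using Suc by simp
qed simp

text \<open>A Potter bound with exponent 1/2. Each halving of n towards r costs a factor 11/10 in
  \<open>f\<close>, while \<open>sqrt (n / r)\<close> falls by about sqrt 2, which is
  larger.\<close>

lemma slow_seq_potter:
  assumes f: "slow_seq f" and nonneg: "\<And>n. f n \<ge> 0"
  obtains C N where "C > 0" "N > 0"
    "\<And>n. n \<ge> N \<Longrightarrow> f n > 0"
    "\<And>n r. n \<ge> N \<Longrightarrow> 0 < r \<Longrightarrow> r \<le> n \<Longrightarrow> f r \<le> C * sqrt (n / r) * f n"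
proof -
  have "\<forall>\<^sub>F m in sequentially. \<forall>n\<in>{m..2*m}. 0 < f m \<and> 0 < f n \<and>
     f m \<le> (1 + 1/10) * f n \<and> f n \<le> (1 + 1/10) * f m"
    using f unfolding slow_seq_def by (rule allE[of _ "1/10"]) simp
  then obtain N0 where N0: "\<And>m n. m \<ge> N0 \<Longrightarrow> m \<le> n \<Longrightarrow> n \<le> 2 * m \<Longrightarrow> 0 < f m \<and> f m \<le> 11/10 * f n"
    unfolding eventually_sequentially by fastforce
  define R where "R = max N0 2"
  have R: "R \<ge> N0" "R \<ge> 2" by (auto simp: R_def)
  have pos: "f n > 0" if "n \<ge> R" for n using N0[of n n] that R by auto
  have A: "f r \<le> 2 * sqrt (n / r) * f n" if "r \<ge> R" "r \<le> n" for n r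
    using that
  proof (induction n rule: less_induct)
    case (less n)
    show ?case
    proof (cases "n \<le> 2 * r")
      case True
      have "f r \<le> 11/10 * f n" using N0[of r n] True less R by auto
      also have "\<dots> \<le> 2 * sqrt (n / r) * f n"
      proof (intro mult_right_mono nonneg)
        have "1 \<le> sqrt (n / r)" using less R by simp
        then show "11 / 10 \<le> 2 * sqrt (n / r)" by linarith
      qed
      finally show ?thesis .
    next
      case False
      \<comment> \<open>Rounding up keeps n \<le> 2 * k, so flatness applies between k and n; the
        rounding is harmless since (11/10)^2 * (n + 1) / 2 \<le> n for n \<ge> 2.\<close>
      define k where "k = (n + 1) div 2"
      have k: "r \<le> k" "k < n" "n \<le> 2 * k" "k \<le> n" "2 * k \<le> n + 1" "n \<ge> 2"
        using False R less by (auto simp: k_def)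
      have "f r \<le> 2 * sqrt (k / r) * f k" using less.IH[of k] k less by auto
      also have "\<dots> \<le> 2 * sqrt (k / r) * (11/10 * f n)"
        using N0[of k n] k less R by (intro mult_left_mono) auto
      also have "\<dots> = 2 * (11/10 * sqrt (k / r)) * f n" by simp
      also have "\<dots> \<le> 2 * sqrt (n / r) * f n"
      proof (intro mult_right_mono mult_left_mono nonneg)
        have "11/10 = sqrt ((11/10)^2)" by simp
        then have "11/10 * sqrt (k / r) = sqrt ((11/10)^2 * (k / r))" by (simp only: real_sqrt_mult)
        also have "\<dots> \<le> sqrt (n / r)"
        proof (rule real_sqrt_le_mono)
          have "(11/10)^2 * real k \<le> n" using k by (simp add: power2_eq_square)
          then show "(11/10)^2 * (k / r) \<le> real n / r" using less R
            by (simp add: divide_right_mono)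
        qed
        finally show "11/10 * sqrt (k / r) \<le> sqrt (n / r)" .
      qed simp
      finally show ?thesis .
    qed
  qed
  \<comment> \<open>The finitely many r < R are absorbed into the constant by comparison with f
    R.\<close>
  define M where "M = (\<Sum>r<R. f r)"
  have M: "M \<ge> 0" unfolding M_def by (simp add: sum_nonneg nonneg)
  define C where "C = 2 * (1 + M / f R)"
  have C: "C \<ge> 2" using M pos[of R] by (simp add: C_def)
  show ?thesis
  proof (rule that[of C R])
    show "f r \<le> C * sqrt (n / r) * f n" if "n \<ge> R" "0 < r" "r \<le> n" for n r
    proof (cases "r \<ge> R")
      case True
      then have "f r \<le> 2 * sqrt (n / r) * f n" using A that by simp
      also have "\<dots> \<le> C * sqrt (n / r) * f n"
        using C by (intro mult_right_mono nonneg) auto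
      finally show ?thesis .
    next
      case False
      have "f r \<le> M" unfolding M_def using False nonneg by (intro member_le_sum) auto
      also have "M = M / f R * f R" using pos[of R] by simp
      also have "\<dots> \<le> M / f R * (2 * sqrt (n / R) * f n)"
        using A[of R n] that M pos[of R] by (intro mult_left_mono) auto
      also have "\<dots> \<le> M / f R * (2 * sqrt (n / r) * f n)"
        using False that M pos[of R]
        by (intro mult_left_mono mult_right_mono real_sqrt_le_mono divide_left_mono nonneg divide_nonneg_nonneg) auto
      also have "\<dots> = (2 * (M / f R)) * (sqrt (n / r) * f n)" by simp
      also have "\<dots> \<le> C * (sqrt (n / r) * f n)"
        by (intro mult_right_mono mult_nonneg_nonneg nonneg) (auto simp: C_def)
      finally show ?thesis by (simp add: mult.assoc)
    qed
  qed (use C R pos in auto)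
qed

text \<open>A one-sided Karamata estimate: the Potter bound leaves the sum of 1 / sqrt r, of order
  sqrt n. As that bound covers only r > 0, the term at 0 is assumed to vanish.\<close>

lemma slow_seq_sum_le:
  assumes f: "slow_seq f" and nonneg: "\<And>n. f n \<ge> 0" and f0: "f 0 = 0"
  shows "\<exists>C>0. \<forall>\<^sub>F n in sequentially. (\<Sum>r\<le>n. f r) \<le> C * real n * f n"
proof -
  obtain C N where C: "C > 0" "N > 0"
    "\<And>n r. n \<ge> N \<Longrightarrow> 0 < r \<Longrightarrow> r \<le> n \<Longrightarrow> f r \<le> C * sqrt (n / r) * f n"
    using slow_seq_potter[OF f nonneg] by metis
  have "(\<Sum>r\<le>n. f r) \<le> 2 * C * real n * f n" if "n \<ge> N" for n
  proof -
    have "(\<Sum>r\<le>n. f r) = (\<Sum>r=1..n. f r)"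
      using f0 by (intro sum.mono_neutral_right) (auto simp: not_less_eq_eq)
    also have "\<dots> \<le> (\<Sum>r=1..n. (C * sqrt n * f n) * (1 / sqrt r))"
      using C(3) that by (intro sum_mono) (force simp: real_sqrt_divide)
    also have "\<dots> = (C * sqrt n * f n) * (\<Sum>r=1..n. 1 / sqrt r)"
      by (simp add: sum_distrib_left)
    also have "\<dots> \<le> (C * sqrt n * f n) * (2 * sqrt n)"
      using C nonneg by (intro mult_left_mono sum_inverse_sqrt_le) auto
    also have "\<dots> = 2 * C * (sqrt n * sqrt n) * f n" by simp
    finally show ?thesis by simp
  qed
  then show ?thesis using C(1) unfolding eventually_sequentially by (intro exI[of _ "2 * C"]) auto
qed

text \<open>Both factors are compared with f n, so the bound is uniform in r. What remains is a
  discrete Beta integral, the sum of 1 / sqrt (i * (r - i)), bounded independently of r.\<close>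

lemma slow_seq_convolution_le:
  assumes f: "slow_seq f" and nonneg: "\<And>n. f n \<ge> 0" and f0: "f 0 = 0"
  shows "\<exists>C>0. \<forall>\<^sub>F n in sequentially. \<forall>r\<le>n. (\<Sum>i\<le>r. f i * f (r - i)) \<le> C * real n * (f n)\<^sup>2"
proof -
  obtain C N where C: "C > 0" "N > 0"
    "\<And>n r. n \<ge> N \<Longrightarrow> 0 < r \<Longrightarrow> r \<le> n \<Longrightarrow> f r \<le> C * sqrt (n / r) * f n"
    using slow_seq_potter[OF f nonneg] by metis
  have "(\<Sum>i\<le>r. f i * f (r - i)) \<le> 8 * C^2 * real n * (f n)\<^sup>2" if "n \<ge> N" "r \<le> n" for n r
  proof (cases "r = 0")
    case True
    then show ?thesis using f0 C nonneg by simp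
  next
    case False
    define K where "K = C^2 * n * (f n)\<^sup>2"
    have K: "K \<ge> 0" by (simp add: K_def)
    have "(\<Sum>i\<le>r. f i * f (r - i)) = (\<Sum>i=1..r-1. f i * f (r - i))"
    proof (intro sum.mono_neutral_right ballI)
      fix i assume "i \<in> {..r} - {1..r-1}"
      then have "i = 0 \<or> r - i = 0" by auto
      then show "f i * f (r - i) = 0" using f0 by auto
    qed auto
    also have "\<dots> \<le> (\<Sum>i=1..r-1. K * (sqrt (2 / r) * (1 / sqrt i + 1 / sqrt (real (r - i)))))"
    proof (rule sum_mono)
      fix i assume i: "i \<in> {1..r-1}"
      define j where "j = r - i"
      have ij: "i > 0" "j > 0" "real r = i + j" "i \<le> r" "j \<le> r" using i by (auto simp: j_def)
      have "f i * f j \<le> (C * sqrt (n / i) * f n) * (C * sqrt (n / j) * f n)"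
        using C(3)[of n i] C(3)[of n j] ij that C(1) nonneg
        by (intro mult_mono) auto
      also have "\<dots> = C^2 * (sqrt n * sqrt n) * (f n)^2 * (1 / (sqrt i * sqrt j))"
        by (simp add: real_sqrt_divide power2_eq_square del: real_sqrt_mult_self)
      also have "\<dots> = K * (1 / (sqrt i * sqrt j))" by (simp add: K_def)
      \<comment> \<open>This splits the Beta kernel into its two endpoint singularities, each summed
        by \<open>sum_inverse_sqrt_le\<close>.\<close>
      also have "\<dots> \<le> K * (sqrt (2 / r) * (1 / sqrt i + 1 / sqrt j))"
      proof (rule mult_left_mono[OF _ K])
        have "sqrt r \<le> sqrt 2 * (sqrt i + sqrt j)"
        proof -
          have "sqrt r \<le> sqrt i + sqrt j" using ij by (simp add: sqrt_add_le_add_sqrt)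
          also have "\<dots> \<le> sqrt 2 * (sqrt i + sqrt j)" using mult_right_mono[of 1 "sqrt 2" "sqrt i + sqrt j"] by simp
          finally show ?thesis .
        qed
        then have "sqrt r / (sqrt r * sqrt i * sqrt j) \<le> sqrt 2 * (sqrt i + sqrt j) / (sqrt r * sqrt i * sqrt j)"
          by (intro divide_right_mono) auto
        also have "\<dots> = sqrt (2 / r) * (1 / sqrt i + 1 / sqrt j)"
          using ij False by (simp add: real_sqrt_divide field_simps)
        finally show "1 / (sqrt i * sqrt j) \<le> sqrt (2 / r) * (1 / sqrt i + 1 / sqrt j)"
          using False by simp
      qed
      finally show "f i * f (r - i) \<le> K * (sqrt (2 / r) * (1 / sqrt i + 1 / sqrt (real (r - i))))"
        by (simp add: j_def)
    qed
    also have "\<dots> = K * sqrt (2 / r) * ((\<Sum>i=1..r-1. 1 / sqrt i) + (\<Sum>i=1..r-1. 1 / sqrt (real (r - i))))"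
      by (simp add: sum_distrib_left sum.distrib algebra_simps)
    also have "(\<Sum>i=1..r-1. 1 / sqrt (real (r - i))) = (\<Sum>i=1..r-1. 1 / sqrt i)"
      by (rule sum.reindex_bij_witness[of _ "\<lambda>i. r - i" "\<lambda>i. r - i"]) auto
    also have "K * sqrt (2 / r) * ((\<Sum>i=1..r-1. 1 / sqrt i) + (\<Sum>i=1..r-1. 1 / sqrt i))
        \<le> K * sqrt (2 / r) * (2 * sqrt r + 2 * sqrt r)"
    proof (intro mult_left_mono add_mono)
      have "(\<Sum>i=1..r-1. 1 / sqrt i) \<le> 2 * sqrt (r - 1)" using sum_inverse_sqrt_le[of "r-1"] by simp
      also have "\<dots> \<le> 2 * sqrt r" by simp
      finally have "(\<Sum>i=1..r-1. 1 / sqrt i) \<le> 2 * sqrt r" .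
      then show "(\<Sum>i=1..r-1. 1 / sqrt i) \<le> 2 * sqrt r" "(\<Sum>i=1..r-1. 1 / sqrt i) \<le> 2 * sqrt r"
        by blast+
    qed (use K in auto)
    also have "\<dots> = (4 * sqrt 2) * K" using False by (simp add: real_sqrt_divide)
    also have "\<dots> \<le> 8 * K" 
      using K sqrt2_less_2 by (intro mult_right_mono) auto
    finally show ?thesis by (simp add: K_def mult_ac)
  qed
  then show ?thesis using C(1) unfolding eventually_sequentially by (intro exI[of _ "8 * C^2"]) auto
qed

text \<open>Each of the J disjoint blocks from 2^i n to 2^(i+1) n carries mass at least n p(n) / 6.
  Together they fit into the tail beyond n, and J can be taken as large as 6 / \<epsilon>.\<close>

lemma slow_seq_tail:
  fixes p :: "nat \<Rightarrow> real"
  assumes p: "\<And>n. p n \<ge> 0" "p sums 1" and f: "slow_seq (\<lambda>n. real n * p n)" and "\<epsilon> > 0"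
  shows "\<forall>\<^sub>F n in sequentially. real n * p n \<le> \<epsilon> * (1 - (\<Sum>m\<le>n. p m))"
proof -
  define F where "F n = (\<Sum>m\<le>n. p m)" for n
  have F1: "F n \<le> 1" for n
    unfolding F_def using p by (metis sum_le_suminf sums_iff finite_atMost)
  define J where "J = Suc (nat \<lceil>6 / \<epsilon>\<rceil>)"
  have J: "J > 0" "6 / \<epsilon> \<le> J" unfolding J_def using \<open>\<epsilon> > 0\<close> by (auto simp: ) linarith
  \<comment> \<open>With d = 1 / J, the distortion (1 + d)^J accumulated over all J doublings stays
    below exp 1 \<le> 3.\<close>
  define d where "d = 1 / real J"
  have d: "d > 0" using J by (simp add: d_def)
  have dJ: "(1 + d) ^ i \<le> 3" if "i \<le> J" for i
  proof -
    have "(1 + d) ^ i \<le> (1 + d) ^ J" using that d by (intro power_increasing) auto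
    also have "\<dots> \<le> exp d ^ J" using d by (intro power_mono) (auto simp: exp_ge_add_one_self)
    also have "\<dots> = exp 1" using J by (simp add: exp_of_nat_mult[symmetric] d_def)
    also have "\<dots> \<le> 3" using exp_le by simp
    finally show ?thesis .
  qed
  have "\<forall>\<^sub>F m in sequentially. \<forall>n\<in>{m..2*m}. m * p m \<le> (1 + d) * (n * p n)"
    using f[unfolded slow_seq_def, rule_format, OF d] by eventually_elim blast
  then obtain R where R: "\<And>m n. m \<ge> R \<Longrightarrow> n \<in> {m..2*m} \<Longrightarrow> m * p m \<le> (1 + d) * (n * p n)"
    unfolding eventually_sequentially by blast
  have "real n * p n \<le> \<epsilon> * (1 - F n)" if n: "n \<ge> R" "n > 0" for n
  proof -
    have pow: "n * p n \<le> (1 + d) ^ i * (real (2 ^ i * n) * p (2 ^ i * n))" for i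
    proof (induction i)
      case (Suc i)
      have "n * p n \<le> (1 + d) ^ i * (real (2 ^ i * n) * p (2 ^ i * n))" by (rule Suc)
      also have "\<dots> \<le> (1 + d) ^ i * ((1 + d) * (real (2 ^ Suc i * n) * p (2 ^ Suc i * n)))"
        using n d by (intro mult_left_mono R) (auto intro: le_trans[of R "1 * n"])
      finally show ?case by (simp add: mult_ac)
    qed simp
    have "F n + i * (n * p n / 6) \<le> F (2 ^ i * n)" if "i \<le> J" for i
      using that
    proof (induction i)
      case (Suc i)
      define k where "k = 2 ^ i * n"
      have k: "k \<ge> n" "k > 0" using n by (auto simp: k_def)
      have "F (2 * k) = F k + (\<Sum>m=k+1..2*k. p m)"
        unfolding F_def by (subst sum.union_disjoint[symmetric]) (auto intro!: sum.cong)
      moreover have "n * p n / 6 \<le> (\<Sum>m=k+1..2*k. p m)"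
      proof -
        \<comment> \<open>The 6 is the distortion bound 3 times the 2 from m \<le> 2 * k; the block
          has k terms.\<close>
        have "p m \<ge> n * p n / (6 * k)" if m: "m \<in> {k+1..2*k}" for m
        proof -
          have "n * p n \<le> (1 + d) ^ i * (k * p k)" using pow[of i] by (simp add: k_def)
          also have "\<dots> \<le> (1 + d) ^ i * ((1 + d) * (m * p m))"
            using n k m d by (intro mult_left_mono R) auto
          also have "\<dots> = (1 + d) ^ Suc i * (m * p m)" by simp
          also have "\<dots> \<le> 3 * (m * p m)" using p Suc.prems by (intro mult_right_mono dJ) auto
          also have "\<dots> \<le> 3 * ((2 * k) * p m)" using m p by (intro mult_left_mono mult_right_mono) auto
          finally show ?thesis using k by (simp add: field_simps)
        qed
        then have "(\<Sum>m=k+1..2*k. n * p n / (6 * k)) \<le> (\<Sum>m=k+1..2*k. p m)"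
          by (intro sum_mono)
        then show ?thesis using k by simp
      qed
      moreover have "F n + i * (n * p n / 6) \<le> F k" using Suc by (simp add: k_def)
      moreover have "Suc i * (n * p n / 6) = i * (n * p n / 6) + n * p n / 6"
        by (simp add: algebra_simps add_divide_distrib)
      ultimately have "F n + Suc i * (n * p n / 6) \<le> F (2 * k)" by linarith
      then show ?case by (simp add: k_def mult.assoc)
    qed simp
    from this[of J] F1[of "2^J * n"] have "J * (n * p n / 6) \<le> 1 - F n" by auto
    moreover have "6 / \<epsilon> * (n * p n / 6) \<le> J * (n * p n / 6)"
      using J p by (intro mult_right_mono) auto
    moreover have "6 / \<epsilon> * (n * p n / 6) = n * p n / \<epsilon>" by simp
    ultimately have "n * p n / \<epsilon> \<le> 1 - F n" by linarith
    then show ?thesis using \<open>\<epsilon> > 0\<close> by (simp add: field_simps)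
  qed
  then show ?thesis unfolding F_def eventually_sequentially
    by (intro exI[of _ "Suc R"]) auto
qed

section \<open>Power series with coefficients of doubling type\<close>

lemma power_tangent_le:
  fixes s t :: real
  assumes "0 \<le> s" "s \<le> t"
  shows "real m * s ^ (m - 1) * (t - s) \<le> t ^ m - s ^ m"
proof (induction m)
  case (Suc m)
  have "real (Suc m) * s ^ m * (t - s) = s * (real m * s ^ (m - 1) * (t - s)) + s ^ m * (t - s)"
    by (cases m) (auto simp: algebra_simps)
  also have "\<dots> \<le> t * (t ^ m - s ^ m) + s ^ m * (t - s)"
    using Suc assms by (intro add_mono mult_mono) (auto simp: power_mono)
  also have "\<dots> = t ^ Suc m - s ^ Suc m" by (simp add: algebra_simps)
  finally show ?case by simp
qed simp

text \<open>The tangent inequality between \<open>x\<close> and \<open>sqrt x\<close> reduces the derivative at \<open>x\<close> to the series at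
  \<open>sqrt x\<close>, whose terms, grouped in pairs, are dominated by those of the series at \<open>x\<close>.\<close>

lemma doubling_power_series:
  fixes b :: "nat \<Rightarrow> real"
  assumes nonneg: "\<And>m. b m \<ge> 0" and pos: "\<exists>m. b m > 0"
    and C: "\<forall>\<^sub>F j in sequentially. b (2 * j) \<le> C * b j \<and> b (2 * j + 1) \<le> C * b j"
    and summ: "\<And>x. 0 \<le> x \<Longrightarrow> x < 1 \<Longrightarrow> summable (\<lambda>m. b m * x ^ m)"
  shows "\<exists>D>0. \<forall>x. 1/2 \<le> x \<and> x < 1 \<longrightarrow> summable (\<lambda>m. real m * b m * x ^ (m - 1)) \<and>
     (\<Sum>m. real m * b m * x ^ (m - 1)) \<le> D / (1 - x) * (\<Sum>m. b m * x ^ m)"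
proof -
  obtain N where N: "\<And>j. j \<ge> N \<Longrightarrow> b (2 * j) \<le> C * b j \<and> b (2 * j + 1) \<le> C * b j"
    using C by (auto simp: eventually_sequentially)
  obtain k where k: "b k > 0" using pos by blast
  \<comment> \<open>\<open>a\<close> bounds the series from below for every x \<ge> 1/2, so the
    constant K from the finitely many exceptional pairs is at most (K / a) times the series.\<close>
  define a where "a = b k * (1/2)^k"
  define K where "K = (\<Sum>j<N. b (2 * j) + b (2 * j + 1))"
  have aK: "a > 0" "K \<ge> 0" using k nonneg by (auto simp: a_def K_def intro!: sum_nonneg add_nonneg_nonneg)
  define D where "D = 4 * (\<bar>2 * C\<bar> + K / a) + 1"
  have "D > 0" using aK by (simp add: D_def add_nonneg_pos)
  moreover have "summable (\<lambda>m. real m * b m * x ^ (m - 1))" (is ?A) 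
     "(\<Sum>m. real m * b m * x ^ (m - 1)) \<le> D / (1 - x) * (\<Sum>m. b m * x ^ m)" (is ?B)
    if x: "1/2 \<le> x" "x < 1" for x
  proof -
    define r where "r = sqrt x"
    have r: "r^2 = x" "0 < r" "r < 1" using x by (auto simp: r_def)
    have rx: "x \<le> r" using r by (simp add: power2_eq_square flip: r(1))
    \<comment> \<open>As r - x = r * (1 - r) and 1 - x = (1 + r) * (1 - r), the claim amounts to r
      \<ge> 1/3.\<close>
    have gap: "(1 - x) / 4 \<le> r - x"
    proof -
      have "1/2 \<le> r" using rx x by simp
      then have "0 \<le> (1 - r) * (3 * r - 1)" using r by (intro mult_nonneg_nonneg) auto
      also have "\<dots> = 4 * (r - x) - (1 - x)"
        by (simp add: power2_eq_square algebra_simps flip: r(1))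
      finally show ?thesis by simp
    qed
    have s: "summable (\<lambda>m. b m * x ^ m)" using summ x by auto
    have sr: "summable (\<lambda>m. b m * r ^ m)" using summ r by auto
    define A where "A = (\<Sum>m. b m * x ^ m)"
    have Apos: "a \<le> A"
    proof -
      have "a \<le> b k * x ^ k" unfolding a_def using x k by (intro mult_left_mono power_mono) auto
      also have "\<dots> \<le> A" unfolding A_def using x nonneg
        using sum_le_suminf[OF s, of "{k}"] by auto
      finally show ?thesis .
    qed
    have "(\<lambda>j. \<Sum>m\<in>{j*2..<j*2+2}. b m * r ^ m) sums (\<Sum>m. b m * r ^ m)"
      using sums_group[OF summable_sums[OF sr], of 2] by simp
    moreover have "(\<Sum>m\<in>{j*2..<j*2+2}. b m * r ^ m) = b (2*j) * r ^ (2*j) + b (2*j+1) * r ^ (2*j+1)" for j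
    proof -
      have "{j*2..<j*2+2} = {2*j, 2*j+1}" by auto
      then show ?thesis by simp
    qed
    ultimately have sums2: "(\<lambda>j. b (2*j) * r ^ (2*j) + b (2*j+1) * r ^ (2*j+1)) sums (\<Sum>m. b m * r ^ m)"
      by simp
    have sums3: "(\<lambda>j. (if j < N then b (2*j) + b (2*j+1) else 0) + \<bar>2*C\<bar> * (b j * x ^ j)) sums (K + \<bar>2*C\<bar> * A)"
    proof (rule sums_add)
      show "(\<lambda>j. if j < N then b (2 * j) + b (2 * j + 1) else 0) sums K"
        using sums_If_finite_set[of "{..<N}" "\<lambda>j. b (2 * j) + b (2 * j + 1)"] by (simp add: K_def)
      show "(\<lambda>j. \<bar>2 * C\<bar> * (b j * x ^ j)) sums (\<bar>2 * C\<bar> * A)"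
        unfolding A_def by (intro sums_mult summable_sums s)
    qed
    \<comment> \<open>Since r^(2j) = x^j, the pair of terms 2j, 2j + 1 at r is compared with the
      single term j at x.\<close>
    have le: "(\<Sum>m. b m * r ^ m) \<le> K + \<bar>2*C\<bar> * A"
    proof (rule sums_le[OF _ sums2 sums3])
      fix j
      have "b (2*j+1) * r ^ (2*j+1) \<le> b (2*j+1) * r ^ (2*j)"
        using r nonneg by (intro mult_left_mono power_decreasing) auto
      then have 1: "b (2*j) * r ^ (2*j) + b (2*j+1) * r ^ (2*j+1) \<le> (b (2*j) + b (2*j+1)) * x ^ j"
        using r(1) by (simp add: power_mult distrib_left distrib_right)
      show "b (2*j) * r ^ (2*j) + b (2*j+1) * r ^ (2*j+1) \<le>
        (if j < N then b (2*j) + b (2*j+1) else 0) + \<bar>2*C\<bar> * (b j * x ^ j)"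
      proof (cases "j < N")
        case True
        have "(b (2*j) + b (2*j+1)) * x ^ j \<le> (b (2*j) + b (2*j+1)) * 1"
          using x nonneg by (intro mult_left_mono power_le_one add_nonneg_nonneg) auto
        moreover have "0 \<le> \<bar>2*C\<bar> * (b j * x ^ j)" using x nonneg by simp
        ultimately show ?thesis using 1 True by simp
      next
        case False
        then have "b (2*j) + b (2*j+1) \<le> 2 * C * b j" using N[of j] by auto
        also have "\<dots> \<le> \<bar>2*C\<bar> * b j" using nonneg by (intro mult_right_mono) auto
        finally have "(b (2*j) + b (2*j+1)) * x ^ j \<le> (\<bar>2*C\<bar> * b j) * x ^ j"
          using x by (intro mult_right_mono) auto
        then show ?thesis using 1 False by (simp add: mult.assoc)
      qed
    qed
    have tangent: "real m * b m * x ^ (m - 1) \<le> (4 / (1 - x)) * (b m * r ^ m)" for m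
    proof -
      have "real m * x ^ (m - 1) * ((1 - x) / 4) \<le> real m * x ^ (m - 1) * (r - x)"
        using x gap by (intro mult_left_mono) auto
      also have "\<dots> \<le> r ^ m - x ^ m" using power_tangent_le[of x r m] x rx by simp
      also have "\<dots> \<le> r ^ m" using x by simp
      finally have "real m * x ^ (m - 1) \<le> 4 / (1 - x) * r ^ m"
        using x by (simp add: field_simps)
      then have "b m * (real m * x ^ (m - 1)) \<le> b m * (4 / (1 - x) * r ^ m)"
        using nonneg by (intro mult_left_mono) auto
      then show ?thesis by (simp add: mult_ac)
    qed
    have sr': "summable (\<lambda>m. (4 / (1 - x)) * (b m * r ^ m))" by (intro summable_mult sr)
    show ?A
      using tangent nonneg x by (intro summable_comparison_test'[OF sr', of 0]) auto
    have "(\<Sum>m. real m * b m * x ^ (m - 1)) \<le> (\<Sum>m. (4 / (1 - x)) * (b m * r ^ m))"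
      using tangent by (intro suminf_le \<open>?A\<close> sr')
    also have "\<dots> = 4 / (1 - x) * (\<Sum>m. b m * r ^ m)" by (rule suminf_mult[OF sr])
    also have "\<dots> \<le> 4 / (1 - x) * (D / 4 * A)"
    proof (rule mult_left_mono)
      have "K \<le> K / a * A" using mult_left_mono[OF Apos aK(2)] aK by (simp add: field_simps)
      moreover have "D / 4 * A = \<bar>2*C\<bar> * A + K / a * A + A / 4"
        by (simp add: D_def algebra_simps add_divide_distrib)
      ultimately have "K + \<bar>2*C\<bar> * A \<le> D / 4 * A" using Apos aK by linarith
      then show "(\<Sum>m. b m * r ^ m) \<le> D / 4 * A" using le by linarith
    qed (use x in auto)
    also have "\<dots> = D / (1 - x) * A" using x by (simp add: divide_simps)
    finally show ?B by (simp add: A_def)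
  qed
  ultimately show ?thesis by blast
qed

text \<open>Supplies the hypotheses of \<open>doubling_power_series\<close>. The shifted index
  matches b(m) = (m + 1) q(m + 1), with g(k) = k^(1-\<alpha>) q(k).\<close>

lemma regularly_varying_coeffs:
  fixes g :: "nat \<Rightarrow> real" and \<alpha> :: real
  assumes g: "slow_seq g"
  defines "b \<equiv> \<lambda>m. real (Suc m) powr \<alpha> * g (Suc m)"
  shows "\<exists>m. b m > 0"
    and "\<exists>C. \<forall>\<^sub>F j in sequentially. b (2 * j) \<le> C * b j \<and> b (2 * j + 1) \<le> C * b j"
    and "0 \<le> x \<Longrightarrow> x < 1 \<Longrightarrow> summable (\<lambda>m. b m * x ^ m)"
proof -
  have ev: "\<exists>N. \<forall>m\<ge>N. \<forall>n\<in>{m..2*m}. 0 < g m \<and> 0 < g n \<and> g m \<le> (1 + \<epsilon>) * g n \<and> g n \<le> (1 + \<epsilon>) * g m"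
    if "\<epsilon> > 0" for \<epsilon>
    using g that by (simp add: slow_seq_def eventually_sequentially)
  from ev[of 1] obtain N where
    N: "\<And>m n. m \<ge> N \<Longrightarrow> m \<le> n \<Longrightarrow> n \<le> 2 * m \<Longrightarrow> 0 < g m \<and> g n \<le> 2 * g m" by force
  have pos: "b m > 0" if "m \<ge> N" for m
    using N[of "Suc m" "Suc m"] that by (simp add: b_def)
  show "\<exists>m. b m > 0" using pos by blast
  \<comment> \<open>The shift gives Suc k \<le> 2 * Suc j even for k = 2 * j + 1, so one doubling
    window suffices.\<close>
  have dbl: "b k \<le> 2 powr \<bar>\<alpha>\<bar> * 2 * b j" if "j \<ge> N" "j \<le> k" "k \<le> 2 * j + 1" for j k
  proof -
    have "real (Suc k) powr \<alpha> \<le> 2 powr \<bar>\<alpha>\<bar> * real (Suc j) powr \<alpha>"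
    proof (cases "\<alpha> \<ge> 0")
      case True
      have "real (Suc k) powr \<alpha> \<le> (2 * real (Suc j)) powr \<alpha>"
        using that True by (intro powr_mono2) auto
      also have "\<dots> = 2 powr \<bar>\<alpha>\<bar> * real (Suc j) powr \<alpha>"
        using True by (subst powr_mult) auto
      finally show ?thesis .
    next
      case False
      have "real (Suc k) powr \<alpha> \<le> 1 * real (Suc j) powr \<alpha>"
        using that False by (simp add: powr_mono2')
      also have "\<dots> \<le> 2 powr \<bar>\<alpha>\<bar> * real (Suc j) powr \<alpha>"
        by (intro mult_right_mono ge_one_powr_ge_zero) auto
      finally show ?thesis .
    qed
    then have "b k \<le> (2 powr \<bar>\<alpha>\<bar> * real (Suc j) powr \<alpha>) * (2 * g (Suc j))"
      unfolding b_def using N[of "Suc k" "Suc k"] N[of "Suc j" "Suc k"] that by (intro mult_mono) auto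
    then show ?thesis by (simp add: b_def mult_ac)
  qed
  show "\<exists>C. \<forall>\<^sub>F j in sequentially. b (2 * j) \<le> C * b j \<and> b (2 * j + 1) \<le> C * b j"
    unfolding eventually_sequentially
    by (intro exI[of _ "2 powr \<bar>\<alpha>\<bar> * 2"] exI[of _ N] allI impI conjI dbl) auto
  show "summable (\<lambda>m. b m * x ^ m)" if x: "0 \<le> x" "x < 1"
  proof -
    \<comment> \<open>Ratio test with c halfway between x and 1: the power and the slowly varying
      factor each grow by at most 1 + e per step, and e is small enough that (1 + e)^2 * x \<le>
      c.\<close>
    define c where "c = (1 + x) / 2"
    have c: "c < 1" "x < c" "c > 0" using x by (auto simp: c_def)
    define e where "e = min 1 ((c - x) / 4)"
    have e: "0 < e" "e \<le> 1" "4 * e \<le> c - x" using c by (auto simp: e_def min_def)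
    have ee: "(1 + e) * (1 + e) * x \<le> c"
    proof -
      have "(1 + e) * (1 + e) = 1 + e * (2 + e)" by algebra
      also have "\<dots> \<le> 1 + e * 3" using e by (intro add_left_mono mult_left_mono) auto
      finally have "(1 + e) * (1 + e) * x \<le> (1 + e * 3) * x" using x by (intro mult_right_mono)
      also have "\<dots> = x + 3 * e * x" by algebra
      also have "\<dots> \<le> x + 3 * e * 1" using x e by (intro add_left_mono mult_left_mono) auto
      finally show ?thesis using e by simp
    qed
    from ev[OF e(1)] obtain N1 where N1: "\<And>m n. m \<ge> N1 \<Longrightarrow> m \<le> n \<Longrightarrow> n \<le> 2 * m \<Longrightarrow> g n \<le> (1 + e) * g m"
      by force
    have "((\<lambda>m. real (Suc (Suc m)) powr \<alpha> / real (Suc m) powr \<alpha>) \<longlongrightarrow> 1) at_top" by real_asymp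
    then have "\<forall>\<^sub>F m in sequentially. real (Suc (Suc m)) powr \<alpha> / real (Suc m) powr \<alpha> < 1 + e"
      by (rule order_tendstoD(2)) (use e in auto)
    then obtain N2 where N2: "\<And>m. m \<ge> N2 \<Longrightarrow> real (Suc (Suc m)) powr \<alpha> / real (Suc m) powr \<alpha> < 1 + e"
      by (auto simp: eventually_sequentially)
    show ?thesis
    proof (rule summable_ratio_test[of c "max N (max N1 N2)"])
      fix m assume "m \<ge> max N (max N1 N2)"
      then have m: "m \<ge> N" "m \<ge> N1" "m \<ge> N2" by auto
      have "real (Suc (Suc m)) powr \<alpha> \<le> (1 + e) * real (Suc m) powr \<alpha>"
        using N2[OF m(3)] by (simp add: divide_less_eq)
      moreover have "g (Suc (Suc m)) \<le> (1 + e) * g (Suc m)" using N1[of "Suc m" "Suc (Suc m)"] m by simp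
      ultimately have "b (Suc m) \<le> ((1 + e) * real (Suc m) powr \<alpha>) * ((1 + e) * g (Suc m))"
        unfolding b_def using N[of "Suc (Suc m)" "Suc (Suc m)"] m e by (intro mult_mono) auto
      also have "\<dots> = (1 + e) * (1 + e) * b m" by (simp add: b_def mult_ac)
      finally have "b (Suc m) * x \<le> (1 + e) * (1 + e) * b m * x" using x by (intro mult_right_mono)
      also have "\<dots> = ((1 + e) * (1 + e) * x) * b m" by simp
      also have "\<dots> \<le> c * b m" using ee pos[OF m(1)] by (intro mult_right_mono) auto
      finally have "b (Suc m) * x * x ^ m \<le> c * b m * x ^ m" using x by (intro mult_right_mono) auto
      then show "norm (b (Suc m) * x ^ Suc m) \<le> c * norm (b m * x ^ m)"
        using pos[OF m(1)] pos[of "Suc m"] m x by (simp add: abs_mult mult_ac)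
    qed (use c in auto)
  qed
qed

section \<open>Convolution powers\<close>

lemma sum_convolution_le:
  fixes f g :: "nat \<Rightarrow> real"
  assumes "\<And>i. f i \<ge> 0" "\<And>i. g i \<ge> 0"
  shows "(\<Sum>j\<le>n. \<Sum>i\<le>j. f i * g (j - i)) \<le> (\<Sum>i\<le>n. f i) * (\<Sum>i\<le>n. g i)"
proof -
  have "(\<Sum>j\<le>n. \<Sum>i\<le>j. f i * g (j - i)) = (\<Sum>(i,j)\<in>{(i,j). i + j \<le> n}. f i * g j)"
    by (rule sum.triangle_reindex_eq[symmetric])
  also have "\<dots> \<le> (\<Sum>(i,j)\<in>{..n} \<times> {..n}. f i * g j)"
    using assms by (intro sum_mono2) auto
  also have "\<dots> = (\<Sum>i\<le>n. f i) * (\<Sum>i\<le>n. g i)"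
    by (simp add: sum_product sum.cartesian_product)
  finally show ?thesis .
qed

text \<open>Makes the recursion, the size-biasing identity and the regrouping of convolutions
  instances of formal power series algebra.\<close>

lemma wconv_eq_fps_nth: "wconv w k n = fps_nth (Abs_fps w ^ k) n"
proof (cases k)
  case 0
  have "comps 0 n = (if n = 0 then {[]} else {})" by (auto simp: comps_def)
  then show ?thesis using 0 by (simp add: wconv_def)
next
  case (Suc h)
  have "prod_list (map w xs) = (\<Prod>j\<in>{0..h}. w (xs ! j))" if "xs \<in> comps k n" for xs
    using that Suc by (auto simp: comps_def prod.list_conv_set_nth atLeastLessThanSuc_atLeastAtMost
        simp del: prod.op_ivl_Suc)
  moreover have "comps k n = natpermute n k" by (simp add: comps_def natpermute_def)
  ultimately show ?thesis unfolding wconv_def using Suc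
    by (simp add: fps_power_nth del: power_Suc)
qed

lemma wconv_nonneg: "(\<And>i. w i \<ge> 0) \<Longrightarrow> wconv w k n \<ge> 0"
  unfolding wconv_def by (intro sum_nonneg prod_list_nonneg) auto

lemma wconv_Suc: "wconv w (Suc k) n = (\<Sum>i\<le>n. w i * wconv w k (n - i))"
  by (simp add: wconv_eq_fps_nth fps_mult_nth atLeast0AtMost)

text \<open>Components with total at most n are each at most n, so the left side is part of the
  expanded power.\<close>

lemma sum_wconv_le:
  assumes "\<And>i. w i \<ge> 0"
  shows "(\<Sum>j\<le>n. wconv w k j) \<le> (\<Sum>i\<le>n. w i) ^ k"
proof (induction k)
  case 0
  show ?case by (simp add: wconv_eq_fps_nth)
next
  case (Suc k)
  have "(\<Sum>j\<le>n. wconv w (Suc k) j) \<le> (\<Sum>i\<le>n. w i) * (\<Sum>i\<le>n. wconv w k i)"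
    unfolding wconv_Suc using assms by (intro sum_convolution_le wconv_nonneg)
  also have "\<dots> \<le> (\<Sum>i\<le>n. w i) * (\<Sum>i\<le>n. w i) ^ k"
    using assms by (intro mult_left_mono Suc sum_nonneg)
  finally show ?case by simp
qed

lemma fps_X_deriv_nth: "fps_nth (fps_X * fps_deriv f) n = of_nat n * fps_nth (f :: real fps) n"
  by (cases n) simp_all

text \<open>Coefficient comparison in z (W^k)' = k (z W') W^(k-1).\<close>

lemma wconv_size_bias:
  "real n * wconv w k n = real k * (\<Sum>i\<le>n. real i * w i * wconv w (k - 1) (n - i))"
proof -
  let ?W = "Abs_fps w"
  have "real n * wconv w k n = fps_nth (fps_X * fps_deriv (?W ^ k)) n"
    by (simp add: wconv_eq_fps_nth fps_X_deriv_nth)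
  also have "fps_X * fps_deriv (?W ^ k) = fps_const (real k) * ((fps_X * fps_deriv ?W) * ?W ^ (k - 1))"
    by (simp add: fps_deriv_power mult_ac)
  also have "fps_nth \<dots> n = real k * (\<Sum>i\<le>n. real i * w i * wconv w (k - 1) (n - i))"
    by (simp only: fps_mult_left_const_nth fps_mult_nth[of "fps_X * fps_deriv ?W"] fps_X_deriv_nth
        wconv_eq_fps_nth atLeast0AtMost) simp
  finally show ?thesis .
qed

text \<open>Size-biasing once leaves a sum over the size \<open>i\<close> of the marked component. For \<open>i \<ge> n/2\<close> it is
  bounded by flatness of \<open>l\<close>; for \<open>i < n/2\<close> the remaining components are size-biased again.\<close>

lemma wconv_local_bound:
  fixes p :: "nat \<Rightarrow> real"
  assumes p: "\<And>i. p i \<ge> 0" and n: "n > 0" and "\<epsilon> \<ge> 0" "C \<ge> 0"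
  defines "l \<equiv> \<lambda>i. real i * p i"
  assumes flat: "\<And>i. i \<le> n \<Longrightarrow> n \<le> 2 * i \<Longrightarrow> l i \<le> (1 + \<epsilon>) * l n"
    and conv: "\<And>r. r \<le> n \<Longrightarrow> (\<Sum>i\<le>r. l i * l (r - i)) \<le> C * real n * (l n)\<^sup>2"
  shows "real n * wconv p (Suc m) n \<le> real (Suc m) * ((1 + \<epsilon>) * l n * (\<Sum>i\<le>n. p i) ^ m
     + 2 * C * (l n)\<^sup>2 * (real m * (\<Sum>i\<le>n. p i) ^ (m - 1)))"
proof -
  let ?F = "\<Sum>i\<le>n. p i"
  define S where "S j = (\<Sum>t\<le>j. l t * wconv p (m - 1) (j - t))" for j
  have l0: "l i \<ge> 0" for i using p by (simp add: l_def)
  have c0: "wconv p k j \<ge> 0" for k j by (rule wconv_nonneg[OF p])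
  have S0: "S j \<ge> 0" for j unfolding S_def by (intro sum_nonneg mult_nonneg_nonneg l0 c0)
  have "l i * wconv p m (n - i) \<le> (1 + \<epsilon>) * l n * wconv p m (n - i) + (2 * m / n) * (l i * S (n - i))"
    if i: "i \<le> n" for i
  proof (cases "n \<le> 2 * i")
    case True
    then have "l i * wconv p m (n - i) \<le> (1 + \<epsilon>) * l n * wconv p m (n - i)"
      using flat i by (intro mult_right_mono c0) auto
    moreover have "0 \<le> (2 * m / n) * (l i * S (n - i))" using l0 S0 by simp
    ultimately show ?thesis by linarith
  next
    case False
    \<comment> \<open>The remaining components still sum to more than n/2, so size-biasing them
      costs only a factor 2 / n.\<close>
    then have pos: "n - i > 0" "real n \<le> 2 * real (n - i)" by linarith+
    have "real (n - i) * wconv p m (n - i) = real m * S (n - i)"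
      unfolding S_def l_def by (rule wconv_size_bias)
    then have "wconv p m (n - i) = real m * S (n - i) / real (n - i)"
      using pos by (simp add: field_simps)
    also have "\<dots> \<le> real m * S (n - i) / (real n / 2)"
      using pos S0 n by (intro divide_left_mono) auto
    finally have "l i * wconv p m (n - i) \<le> l i * (real m * S (n - i) / (real n / 2))"
      by (rule mult_left_mono[OF _ l0])
    moreover have "0 \<le> (1 + \<epsilon>) * l n * wconv p m (n - i)" using l0 c0 \<open>\<epsilon> \<ge> 0\<close> by simp
    ultimately show ?thesis by (simp add: field_simps)
  qed
  then have "(\<Sum>i\<le>n. l i * wconv p m (n - i)) \<le>
      (\<Sum>i\<le>n. (1 + \<epsilon>) * l n * wconv p m (n - i) + (2 * m / n) * (l i * S (n - i)))"
    by (intro sum_mono) auto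
  also have "\<dots> = (1 + \<epsilon>) * l n * (\<Sum>i\<le>n. wconv p m (n - i)) + (2 * m / n) * (\<Sum>i\<le>n. l i * S (n - i))"
    by (simp add: sum.distrib sum_distrib_left)
  also have "(\<Sum>i\<le>n. wconv p m (n - i)) = (\<Sum>j\<le>n. wconv p m j)"
    using sum.nat_diff_reindex[of "\<lambda>j. wconv p m j" "Suc n"]
    by (simp add: lessThan_Suc_atMost)
  \<comment> \<open>Regrouping l * (l * p^(m-1)) as (l * l) * p^(m-1) brings the two marked
    components together, where \<open>conv\<close> applies.\<close>
  also have "(\<Sum>i\<le>n. l i * S (n - i)) = (\<Sum>j\<le>n. (\<Sum>i\<le>j. l i * l (j - i)) * wconv p (m - 1) (n - j))"
  proof -
    let ?L = "Abs_fps l" and ?Q = "Abs_fps p ^ (m - 1)"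
    have "(\<Sum>i\<le>n. l i * S (n - i)) = fps_nth (?L * (?L * ?Q)) n"
      by (simp add: S_def fps_mult_nth wconv_eq_fps_nth atLeast0AtMost)
    also have "\<dots> = fps_nth ((?L * ?L) * ?Q) n" by (simp add: mult.assoc)
    also have "\<dots> = (\<Sum>j\<le>n. (\<Sum>i\<le>j. l i * l (j - i)) * wconv p (m - 1) (n - j))"
      by (simp add: fps_mult_nth[of "?L * ?L"] fps_mult_nth[of ?L ?L] wconv_eq_fps_nth atLeast0AtMost)
    finally show ?thesis .
  qed
  also have "(1 + \<epsilon>) * l n * (\<Sum>j\<le>n. wconv p m j) +
      (2 * m / n) * (\<Sum>j\<le>n. (\<Sum>i\<le>j. l i * l (j - i)) * wconv p (m - 1) (n - j))
    \<le> (1 + \<epsilon>) * l n * ?F ^ m + (2 * m / n) * ((C * real n * (l n)\<^sup>2) * ?F ^ (m - 1))"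
  proof (intro add_mono mult_left_mono)
    have "(\<Sum>j\<le>n. (\<Sum>i\<le>j. l i * l (j - i)) * wconv p (m - 1) (n - j))
      \<le> (\<Sum>j\<le>n. (C * real n * (l n)\<^sup>2) * wconv p (m - 1) (n - j))"
      by (intro sum_mono mult_right_mono conv c0) auto
    also have "\<dots> = (C * real n * (l n)\<^sup>2) * (\<Sum>j\<le>n. wconv p (m - 1) (n - j))"
      by (simp add: sum_distrib_left)
    also have "(\<Sum>j\<le>n. wconv p (m - 1) (n - j)) = (\<Sum>j\<le>n. wconv p (m - 1) j)"
      using sum.nat_diff_reindex[of "\<lambda>j. wconv p (m - 1) j" "Suc n"]
      by (simp add: lessThan_Suc_atMost)
    also have "(C * real n * (l n)\<^sup>2) * (\<Sum>j\<le>n. wconv p (m - 1) j) \<le> (C * real n * (l n)\<^sup>2) * ?F ^ (m - 1)"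
      using \<open>C \<ge> 0\<close> p by (intro mult_left_mono sum_wconv_le) auto
    finally show "(\<Sum>j\<le>n. (\<Sum>i\<le>j. l i * l (j - i)) * wconv p (m - 1) (n - j))
      \<le> (C * real n * (l n)\<^sup>2) * ?F ^ (m - 1)" .
  qed (use p l0 \<open>\<epsilon> \<ge> 0\<close> in \<open>auto intro: sum_wconv_le\<close>)
  finally have "(\<Sum>i\<le>n. l i * wconv p m (n - i)) \<le> (1 + \<epsilon>) * l n * ?F ^ m
      + 2 * C * (l n)\<^sup>2 * (real m * ?F ^ (m - 1))"
    using n by (simp add: mult_ac)
  then have "real (Suc m) * (\<Sum>i\<le>n. l i * wconv p m (n - i)) \<le> real (Suc m) * ((1 + \<epsilon>) * l n * ?F ^ m
      + 2 * C * (l n)\<^sup>2 * (real m * ?F ^ (m - 1)))"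
    by (intro mult_left_mono) auto
  moreover have "real n * wconv p (Suc m) n = real (Suc m) * (\<Sum>i\<le>n. l i * wconv p m (n - i))"
    unfolding l_def using wconv_size_bias[of n p "Suc m"] by simp
  ultimately show ?thesis by simp
qed

section \<open>Sequences of random length\<close>

lemma pmf_replicate_pmf:
  "pmf (replicate_pmf m Y) xs = (if length xs = m then prod_list (map (pmf Y) xs) else 0)"
proof (induction m arbitrary: xs)
  case 0
  show ?case by (auto simp: indicator_def)
next
  case (Suc m)
  have eq: "replicate_pmf (Suc m) Y = map_pmf (\<lambda>(x, xs). x # xs) (pair_pmf Y (replicate_pmf m Y))"
    by (simp add: pair_pmf_def map_pmf_def bind_assoc_pmf bind_return_pmf)
  show ?case
  proof (cases xs)
    case Nil
    then show ?thesis unfolding eq by (auto intro!: pmf_map_outside)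
  next
    case (Cons y ys)
    have "inj (\<lambda>(x :: 'a, xs). x # xs)" by (auto simp: inj_def)
    from pmf_map_inj'[OF this, of "pair_pmf Y (replicate_pmf m Y)" "(y, ys)"]
    show ?thesis unfolding eq Cons by (simp add: pmf_pair Suc)
  qed
qed

lemma nn_integral_sum_list_replicate_pmf:
  "(\<integral>\<^sup>+xs. ennreal (real (sum_list xs)) \<partial>replicate_pmf m Y) = of_nat m * (\<integral>\<^sup>+x. ennreal (real x) \<partial>measure_pmf Y)"
proof (induction m)
  case (Suc m)
  let ?R = "replicate_pmf m Y"
  have "(\<integral>\<^sup>+xs. ennreal (real (sum_list xs)) \<partial>replicate_pmf (Suc m) Y) =
    (\<integral>\<^sup>+x. \<integral>\<^sup>+xs. ennreal (real x) + ennreal (real (sum_list xs)) \<partial>?R \<partial>Y)"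
    by simp
  also have "\<dots> = (\<integral>\<^sup>+x. ennreal (real x) + (\<integral>\<^sup>+xs. ennreal (real (sum_list xs)) \<partial>?R) \<partial>Y)"
    by (simp add: nn_integral_add measure_pmf.emeasure_space_1)
  also have "\<dots> = (\<integral>\<^sup>+x. ennreal (real x) \<partial>Y) + of_nat m * (\<integral>\<^sup>+x. ennreal (real x) \<partial>Y)"
    by (simp add: nn_integral_add Suc measure_pmf.emeasure_space_1)
  finally show ?case by (simp add: distrib_right)
qed simp

section \<open>Comparison of laws and tail bounds\<close>

text \<open>One-sided domination off a set of small \<open>M\<close>-mass suffices: used for f and
  for 1 - f, it bounds the difference on both sides. Functions replace events because kernels are
  applied later.\<close>

lemma expectation_lower_bound:
  fixes P M :: "'a pmf" and f :: "'a \<Rightarrow> real"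
  assumes dom: "\<And>x. x \<in> G \<Longrightarrow> (1 - \<epsilon>) * pmf M x \<le> pmf P x"
    and f: "\<And>x. 0 \<le> f x" "\<And>x. f x \<le> 1"
    and eps: "0 \<le> \<epsilon>" "\<epsilon> \<le> 1" and G: "measure_pmf.prob M (- G) \<le> \<delta>"
  shows "measure_pmf.expectation M f - \<epsilon> - \<delta> \<le> measure_pmf.expectation P f"
proof -
  have int: "integrable (measure_pmf Q) f" for Q
    using f by (intro measure_pmf.integrable_const_bound[where B=1]) auto
  have intI: "integrable (measure_pmf Q) (\<lambda>x. f x * indicator A x)" for Q A
    using f by (intro measure_pmf.integrable_const_bound[where B=1]) (auto simp: indicator_def)
  have "ennreal ((1 - \<epsilon>) * measure_pmf.expectation M (\<lambda>x. f x * indicator G x))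
      = ennreal (1 - \<epsilon>) * (\<integral>\<^sup>+x. ennreal (f x * indicator G x) \<partial>M)"
  proof -
    have "(\<integral>\<^sup>+x. ennreal (f x * indicator G x) \<partial>M) = ennreal (measure_pmf.expectation M (\<lambda>x. f x * indicator G x))"
      using f by (intro nn_integral_eq_integral intI) auto
    then show ?thesis using f eps by (simp only:) (intro ennreal_mult integral_nonneg_AE, auto)
  qed
  also have "\<dots> = (\<integral>\<^sup>+x. ennreal (1 - \<epsilon>) * (ennreal (pmf M x) * ennreal (f x * indicator G x)) \<partial>count_space UNIV)"
    by (simp add: nn_integral_measure_pmf nn_integral_cmult)
  also have "\<dots> \<le> (\<integral>\<^sup>+x. ennreal (pmf P x) * ennreal (f x) \<partial>count_space UNIV)"
  proof (rule nn_integral_mono)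
    fix x
    show "ennreal (1 - \<epsilon>) * (ennreal (pmf M x) * ennreal (f x * indicator G x)) \<le> ennreal (pmf P x) * ennreal (f x)"
    proof (cases "x \<in> G")
      case True
      have "(1 - \<epsilon>) * (pmf M x * f x) \<le> pmf P x * f x"
        using mult_right_mono[OF dom[OF True] f(1)[of x]] by (simp add: mult.assoc)
      then show ?thesis using True eps f by (simp flip: ennreal_mult add: ennreal_leI)
    qed simp
  qed
  also have "\<dots> = ennreal (measure_pmf.expectation P f)"
    using f int by (simp add: nn_integral_measure_pmf[symmetric] nn_integral_eq_integral)
  finally have 1: "(1 - \<epsilon>) * measure_pmf.expectation M (\<lambda>x. f x * indicator G x) \<le> measure_pmf.expectation P f"
    using f by (subst (asm) ennreal_le_iff) (auto intro!: integral_nonneg_AE)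
  have "measure_pmf.expectation M f = measure_pmf.expectation M (\<lambda>x. f x * indicator G x + f x * indicator (- G) x)"
    by (intro Bochner_Integration.integral_cong) (auto simp: indicator_def)
  also have "\<dots> = measure_pmf.expectation M (\<lambda>x. f x * indicator G x) + measure_pmf.expectation M (\<lambda>x. f x * indicator (- G) x)"
    by (intro Bochner_Integration.integral_add intI)
  also have "measure_pmf.expectation M (\<lambda>x. f x * indicator (- G) x) \<le> measure_pmf.expectation M (indicator (- G))"
    using f by (intro integral_mono intI measure_pmf.integrable_const_bound[where B=1]) (auto simp: indicator_def)
  also have "\<dots> \<le> \<delta>" using G by simp
  finally have 2: "measure_pmf.expectation M f - \<delta> \<le> measure_pmf.expectation M (\<lambda>x. f x * indicator G x)" by simp
  have "measure_pmf.expectation M (\<lambda>x. f x * indicator G x) \<le> measure_pmf.expectation M (\<lambda>x. 1)"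
    using f by (intro integral_mono intI) (auto simp: indicator_def)
  then have "\<epsilon> * measure_pmf.expectation M (\<lambda>x. f x * indicator G x) \<le> \<epsilon> * 1"
    using eps by (intro mult_left_mono) auto
  with 1 2 show ?thesis by (simp add: algebra_simps)
qed

lemma prob_bind_pmf:
  "measure_pmf.prob (bind_pmf P K) A = measure_pmf.expectation P (\<lambda>x. measure_pmf.prob (K x) A)"
proof -
  have "ennreal (measure_pmf.prob (bind_pmf P K) A) = (\<integral>\<^sup>+x. ennreal (measure_pmf.prob (K x) A) \<partial>P)"
    by (simp flip: measure_pmf.emeasure_eq_measure)
  also have "\<dots> = ennreal (measure_pmf.expectation P (\<lambda>x. measure_pmf.prob (K x) A))"
    by (intro nn_integral_eq_integral measure_pmf.integrable_const_bound[where B=1]) auto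
  finally show ?thesis by (subst (asm) ennreal_inj) (auto intro!: integral_nonneg_AE)
qed

text \<open>Markov's inequality, with the mean expressed as a nonnegative integral.\<close>

lemma prob_sum_list_ge_le:
  fixes M :: "nat list pmf"
  assumes "t > 0" "(\<integral>\<^sup>+xs. ennreal (real (sum_list xs)) \<partial>M) \<le> ennreal e" "e \<ge> 0"
  shows "measure_pmf.prob M {xs. t \<le> real (sum_list xs)} \<le> e / t"
proof -
  have "ennreal (measure_pmf.prob M {xs. t \<le> real (sum_list xs)}) =
      (\<integral>\<^sup>+xs. indicator {xs. t \<le> real (sum_list xs)} xs \<partial>M)"
    by (simp flip: measure_pmf.emeasure_eq_measure)
  also have "\<dots> \<le> (\<integral>\<^sup>+xs. ennreal (1 / t) * ennreal (real (sum_list xs)) \<partial>M)"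
    using assms(1)
    by (intro nn_integral_mono) (auto simp: indicator_def simp flip: ennreal_mult simp del: ennreal_1 simp: ennreal_1[symmetric] intro!: ennreal_leI)
  also have "\<dots> = ennreal (1 / t) * (\<integral>\<^sup>+xs. ennreal (real (sum_list xs)) \<partial>M)"
    by (simp add: nn_integral_cmult)
  also have "\<dots> \<le> ennreal (1 / t) * ennreal e" using assms by (intro mult_left_mono) auto
  also have "\<dots> = ennreal (e / t)" using assms by (simp flip: ennreal_mult)
  finally show ?thesis using assms by (subst (asm) ennreal_le_iff) auto
qed

section \<open>The operator \<open>tau\<close> and its preimages\<close>

lemma length_tau: "length (tau xs) = length xs - 1"
proof (cases "xs = []")
  case False
  then have "Max (set xs) \<in> set xs" by simp
  then show ?thesis by (simp add: tau_def length_remove1)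
qed (simp add: tau_def)

lemma sum_list_tau:
  assumes "xs \<noteq> []"
  shows "largest xs + sum_list (tau xs) = sum_list xs"
  using assms sum_list_map_remove1[of "Max (set xs)" xs id] by (simp add: largest_def tau_def)

lemma largest_le_sum_list: "largest xs \<le> sum_list xs"
  by (auto simp: largest_def intro: member_le_sum_list)

text \<open>The number n minus the sum exceeds every entry, so wherever it is inserted it is the
  unique maximum and \<open>tau\<close> removes it. The length + 1 positions give different
  lists.\<close>

lemma card_tau_preimages:
  assumes "2 * sum_list xs < n"
  shows "card {ks. ks \<noteq> [] \<and> tau ks = xs \<and> sum_list ks = n \<and> length ks = Suc (length xs)
      \<and> prod_list (map (p :: nat \<Rightarrow> real) ks) = p (n - sum_list xs) * prod_list (map p xs)} \<ge> Suc (length xs)"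
    (is "card ?A \<ge> _")
proof -
  define a where "a = n - sum_list xs"
  define ins where "ins i = take i xs @ a # drop i xs" for i
  have a: "a > x" if "x \<in> set xs" for x
    using member_le_sum_list[OF that] assms by (simp add: a_def)
  have a': "a \<notin> set xs" using a by blast
  have fin: "finite ?A"
    by (rule finite_subset[OF _ finite_lists_length_eq[of "{..n}" "Suc (length xs)"]])
       (auto intro: member_le_sum_list)
  have "inj_on ins {..length xs}"
  proof (rule inj_onI)
    fix i j assume ij: "i \<in> {..length xs}" "j \<in> {..length xs}" "ins i = ins j"
    \<comment> \<open>The place of insertion is recovered as the length of the prefix before the
      first \<open>a\<close>.\<close>
    have "length (takeWhile (\<lambda>x. x \<noteq> a) (ins i)) = i" if "i \<le> length xs" for i
    proof -
      have "takeWhile (\<lambda>x. x \<noteq> a) (ins i) = take i xs @ takeWhile (\<lambda>x. x \<noteq> a) (a # drop i xs)"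
        unfolding ins_def using a' by (intro takeWhile_append2) (auto dest: in_set_takeD)
      then show ?thesis using that by simp
    qed
    then show "i = j" using ij by (metis atMost_iff)
  qed
  moreover have "ins ` {..length xs} \<subseteq> ?A"
  proof
    fix ks assume "ks \<in> ins ` {..length xs}"
    then obtain i where i: "i \<le> length xs" "ks = ins i" by auto
    have "set ks = insert a (set xs)"
      using i by (metis ins_def append_take_drop_id list.simps(15) set_append Un_insert_right)
    then have "Max (set ks) = a" using a by (intro Max_eqI) (auto intro: less_imp_le)
    moreover have "remove1 a ks = xs"
      using a' i by (auto simp: ins_def remove1_append dest: in_set_takeD)
    moreover have "sum_list ks = n"
    proof -
      have "sum_list ks = a + (sum_list (take i xs) + sum_list (drop i xs))" by (simp add: i ins_def)
      also have "\<dots> = a + sum_list xs" by (simp flip: sum_list_append)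
      finally show ?thesis using assms by (simp add: a_def)
    qed
    moreover have "prod_list (map p ks) = p a * prod_list (map p xs)"
    proof -
      have "prod_list (map p ks) = p a * (prod_list (map p (take i xs)) * prod_list (map p (drop i xs)))"
        by (simp add: i ins_def)
      also have "\<dots> = p a * prod_list (map p xs)" 
        by (simp flip: prod_list.append map_append)
      finally show ?thesis .
    qed
    ultimately show "ks \<in> ?A" using i by (auto simp: tau_def a_def ins_def)
  qed
  ultimately have "card {..length xs} \<le> card ?A" using fin by (intro card_inj_on_le) auto
  then show ?thesis by simp
qed

lemma tv_dist_le:
  assumes "\<And>A. \<bar>measure_pmf.prob P A - measure_pmf.prob Q A\<bar> \<le> e"
  shows "tv_dist P Q \<le> e"
  unfolding tv_dist_def using assms by (intro cSUP_least) auto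

section \<open>Gibbs partitions\<close>

lemma finite_comps: "finite (comps k n)"
  by (rule finite_subset[OF _ finite_lists_length_eq[of "{..n}" k]])
     (auto simp: comps_def intro: member_le_sum_list)

text \<open>\<open>embed_pmf\<close> has the prescribed masses once they add up to one; splitting
  the lists by length turns their total into the series for u(n), divided by u(n).\<close>

lemma pmf_gibbs_pmf:
  assumes w: "\<And>i. w i \<ge> 0" and v: "\<And>k. k \<ge> 1 \<Longrightarrow> v k \<ge> 0"
    and u: "0 < gibbs_u v w n" "gibbs_u v w n < \<top>"
  shows "pmf (gibbs_pmf v w n) xs = (if xs \<noteq> [] \<and> sum_list xs = n
      then v (length xs) * prod_list (map w xs) / enn2real (gibbs_u v w n) else 0)"
proof -
  define U where "U = enn2real (gibbs_u v w n)"
  have U: "U > 0" "gibbs_u v w n = ennreal U"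
    using u by (auto simp: U_def enn2real_positive_iff)
  define h where "h xs = v (length xs) * prod_list (map w xs) / U" for xs
  define f where "f = (\<lambda>xs. if xs \<noteq> [] \<and> sum_list xs = n then h xs else 0)"
  have h0: "h xs \<ge> 0" if "xs \<noteq> []" for xs
    unfolding h_def using w v that U
    by (auto intro!: divide_nonneg_pos mult_nonneg_nonneg prod_list_nonneg v simp: Suc_le_eq)
  have f0: "f xs \<ge> 0" for xs using h0 by (auto simp: f_def)
  have f_eq: "ennreal (f xs) = (\<Sum>k. ennreal (h xs) * indicator (comps (Suc k) n) xs)" for xs
  proof (cases "xs \<noteq> [] \<and> sum_list xs = n")
    case True
    then have "xs \<in> comps (Suc (length xs - 1)) n" by (auto simp: comps_def)
    moreover have "disjoint_family (\<lambda>k. comps (Suc k) n)" by (auto simp: disjoint_family_on_def comps_def)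
    ultimately have "(\<Sum>k. ennreal (h xs) * indicator (comps (Suc k) n) xs) = ennreal (h xs)"
      by (intro suminf_cmult_indicator[of _ xs "length xs - 1" "\<lambda>_. ennreal (h xs)"]) auto
    then show ?thesis using True by (simp add: f_def)
  next
    case False
    then have "xs \<notin> comps (Suc k) n" for k by (auto simp: comps_def)
    then show ?thesis using False by (auto simp: f_def)
  qed
  have "(\<integral>\<^sup>+xs. ennreal (f xs) \<partial>count_space UNIV) =
      (\<Sum>k. \<integral>\<^sup>+xs. ennreal (h xs) * indicator (comps (Suc k) n) xs \<partial>count_space UNIV)"
    unfolding f_eq by (rule nn_integral_suminf) auto
  also have "\<dots> = (\<Sum>k. ennreal (v (Suc k) * wconv w (Suc k) n) * ennreal (1 / U))"
  proof (rule suminf_cong)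
    fix k
    have "(\<integral>\<^sup>+xs. ennreal (h xs) * indicator (comps (Suc k) n) xs \<partial>count_space UNIV)
        = (\<Sum>xs\<in>comps (Suc k) n. ennreal (h xs))"
      using finite_comps
      by (subst nn_integral_count_space_indicator[symmetric]) (auto simp: nn_integral_count_space_finite)
    also have "\<dots> = ennreal (\<Sum>xs\<in>comps (Suc k) n. h xs)"
      by (intro sum_ennreal h0) (auto simp: comps_def)
    also have "(\<Sum>xs\<in>comps (Suc k) n. h xs) = v (Suc k) * wconv w (Suc k) n * (1 / U)"
      unfolding wconv_def sum_distrib_left sum_distrib_right
      by (intro sum.cong) (auto simp: comps_def h_def)
    finally show "(\<integral>\<^sup>+xs. ennreal (h xs) * indicator (comps (Suc k) n) xs \<partial>count_space UNIV)
        = ennreal (v (Suc k) * wconv w (Suc k) n) * ennreal (1 / U)"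
      using U w v by (simp flip: ennreal_mult add: wconv_nonneg)
  qed
  also have "\<dots> = gibbs_u v w n * ennreal (1 / U)"
    unfolding gibbs_u_def by simp
  also have "\<dots> = 1" using U by (simp flip: ennreal_mult)
  finally have "(\<integral>\<^sup>+xs. ennreal (f xs) \<partial>count_space UNIV) = 1" .
  then have "pmf (embed_pmf f) xs = f xs" using f0 by (intro pmf_embed_pmf) auto
  then show ?thesis unfolding gibbs_pmf_def f_def h_def U_def .
qed

text \<open>Allows the component weights to be taken as a probability distribution.\<close>

lemma gibbs_tilt:
  fixes w v :: "nat \<Rightarrow> real"
  assumes "\<rho> > 0" "W > 0"
  defines "p \<equiv> \<lambda>m. w m * \<rho> ^ m / W" and "q \<equiv> \<lambda>k. v k * W ^ k"
  shows "gibbs_u q p n = ennreal (\<rho> ^ n) * gibbs_u v w n" (is ?u)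
    and "gibbs_pmf q p n = gibbs_pmf v w n" (is ?pmf)
proof -
  \<comment> \<open>The power of \<rho> depends only on the sum, which is fixed to n, and the power
    of W only on the length, where the tilt of \<open>v\<close> cancels it.\<close>
  have prod: "prod_list (map p xs) = prod_list (map w xs) * \<rho> ^ sum_list xs / W ^ length xs" for xs
    by (induction xs) (auto simp: p_def power_add)
  have wconv: "wconv p k n = wconv w k n * \<rho> ^ n / W ^ k" for k
    unfolding wconv_def sum_distrib_right sum_divide_distrib
    by (intro sum.cong) (auto simp: prod comps_def)
  have qp: "q k * wconv p k n = \<rho> ^ n * (v k * wconv w k n)" for k
    using assms(1,2) by (simp add: wconv q_def)
  show u: ?u
    unfolding gibbs_u_def qp using assms(1,2) by (simp add: ennreal_mult')
  have "(\<lambda>xs. if xs \<noteq> [] \<and> sum_list xs = n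
      then q (length xs) * prod_list (map p xs) / enn2real (gibbs_u q p n) else 0) =
    (\<lambda>xs. if xs \<noteq> [] \<and> sum_list xs = n
      then v (length xs) * prod_list (map w xs) / enn2real (gibbs_u v w n) else 0)"
    unfolding u using assms(1,2) by (auto simp: fun_eq_iff prod q_def enn2real_mult)
  then show ?pmf by (simp add: gibbs_pmf_def)
qed

text \<open>The estimates at a fixed \<open>n\<close>. To leading order \<open>u\<^sub>n\<close> is \<open>p\<^sub>n A\<close>: one of the \<open>m + 1\<close> components is
  giant, with weight about \<open>p\<^sub>n\<close>, and the other \<open>m\<close> are at most \<open>n\<close>.\<close>

locale gibbs_stage =
  fixes X :: "nat pmf" and q :: "nat \<Rightarrow> real" and n :: nat and \<epsilon> C \<delta> :: real
    and l :: "nat \<Rightarrow> real" and b :: "nat \<Rightarrow> real" and F A B :: real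
  defines "l \<equiv> \<lambda>i. real i * pmf X i"
    and "b \<equiv> \<lambda>m. real (Suc m) * q (Suc m)"
    and "F \<equiv> \<Sum>i\<le>n. pmf X i"
    and "A \<equiv> \<Sum>m. b m * F ^ m"
    and "B \<equiv> \<Sum>m. real m * b m * F ^ (m - 1)"
  assumes q: "\<And>k. k \<ge> 1 \<Longrightarrow> q k \<ge> 0"
    and n: "n > 0" and eps: "0 < \<epsilon>" "3 * \<epsilon> \<le> 1" and C: "C \<ge> 0" and \<delta>: "\<delta> \<ge> 0"
    and lpos: "l n > 0"
    and flat: "\<And>i. i \<le> n \<Longrightarrow> n \<le> 2 * i \<Longrightarrow> l i \<le> (1 + \<epsilon>) * l n \<and> (1 - \<epsilon>) * l n \<le> l i"
    and conv: "\<And>r. r \<le> n \<Longrightarrow> (\<Sum>i\<le>r. l i * l (r - i)) \<le> C * real n * (l n)\<^sup>2"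
    and summable_A: "summable (\<lambda>m. b m * F ^ m)"
    and summable_B: "summable (\<lambda>m. real m * b m * F ^ (m - 1))"
    and A_pos: "A > 0"
    and second_order: "2 * C * l n * B \<le> \<epsilon> * A"
    and drift: "(\<Sum>i\<le>n. l i) * B \<le> \<delta> * real n * A"
    and u: "0 < gibbs_u q (pmf X) n" "gibbs_u q (pmf X) n < \<top>"
begin

definition "U = enn2real (gibbs_u q (pmf X) n)"

lemma U_pos_eq: "U > 0" "gibbs_u q (pmf X) n = ennreal U"
  using u by (auto simp: U_def enn2real_positive_iff)

lemma pmf_X_n: "pmf X n > 0" "l n = real n * pmf X n"
  using lpos n by (auto simp: l_def zero_less_mult_iff)

lemma F_pos: "F > 0"
proof -
  have "pmf X n \<le> F" unfolding F_def by (intro member_le_sum) auto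
  then show ?thesis using pmf_X_n by simp
qed

lemma b_nonneg: "b m \<ge> 0"
  using q by (simp add: b_def)

lemma B_nonneg: "B \<ge> 0"
  unfolding B_def using F_pos b_nonneg by (intro suminf_nonneg summable_B) auto

text \<open>\<open>wconv_local_bound\<close> summed against \<open>q\<close>: the leading terms add
  up to A, the corrections to B, and \<open>second_order\<close> absorbs the latter at the cost of a
  further \<epsilon>.\<close>

lemma U_le: "U \<le> (1 + 2 * \<epsilon>) * pmf X n * A"
proof -
  let ?r = "\<lambda>m. (1 + \<epsilon>) * l n * (b m * F ^ m) + 2 * C * (l n)\<^sup>2 * (real m * b m * F ^ (m - 1))"
  have sums: "?r sums ((1 + \<epsilon>) * l n * A + 2 * C * (l n)\<^sup>2 * B)"
    unfolding A_def B_def by (intro sums_add sums_mult summable_sums summable_A summable_B)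
  have term_le: "real n * (q (Suc m) * wconv (pmf X) (Suc m) n) \<le> ?r m" for m
  proof -
    have "real n * wconv (pmf X) (Suc m) n \<le> real (Suc m) * ((1 + \<epsilon>) * l n * F ^ m
        + 2 * C * (l n)\<^sup>2 * (real m * F ^ (m - 1)))"
      unfolding l_def F_def using flat conv eps C n unfolding l_def
      by (intro wconv_local_bound) auto
    then have "q (Suc m) * (real n * wconv (pmf X) (Suc m) n) \<le> q (Suc m) * (real (Suc m) * ((1 + \<epsilon>) * l n * F ^ m
        + 2 * C * (l n)\<^sup>2 * (real m * F ^ (m - 1))))"
      using q by (intro mult_left_mono) auto
    also have "\<dots> = ?r m" by (simp add: b_def algebra_simps)
    finally show ?thesis by (simp add: mult_ac)
  qed
  have r0: "?r m \<ge> 0" for m using b_nonneg F_pos eps C lpos by (intro add_nonneg_nonneg mult_nonneg_nonneg) auto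
  have "ennreal (real n * U) = ennreal (real n) * gibbs_u q (pmf X) n"
    using U_pos_eq by (simp add: ennreal_mult)
  also have "\<dots> = (\<Sum>m. ennreal (real n) * ennreal (q (Suc m) * wconv (pmf X) (Suc m) n))"
    unfolding gibbs_u_def by simp
  also have "\<dots> \<le> (\<Sum>m. ennreal (?r m))"
    using term_le q by (intro suminf_le) (auto simp flip: ennreal_mult simp: wconv_nonneg intro!: ennreal_leI)
  also have "\<dots> = ennreal ((1 + \<epsilon>) * l n * A + 2 * C * (l n)\<^sup>2 * B)"
    using sums r0 by (intro suminf_ennreal_eq) auto
  finally have "real n * U \<le> (1 + \<epsilon>) * l n * A + 2 * C * (l n)\<^sup>2 * B"
    by (subst (asm) ennreal_le_iff)
       (use eps lpos A_pos B_nonneg C in \<open>auto intro!: add_nonneg_nonneg mult_nonneg_nonneg\<close>)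
  also have "\<dots> = (1 + \<epsilon>) * l n * A + l n * (2 * C * l n * B)" by (simp add: power2_eq_square)
  also have "\<dots> \<le> (1 + \<epsilon>) * l n * A + l n * (\<epsilon> * A)"
    using second_order lpos by (intro add_left_mono mult_left_mono) auto
  also have "\<dots> = real n * ((1 + 2 * \<epsilon>) * pmf X n * A)" by (simp add: pmf_X_n(2) algebra_simps)
  finally show ?thesis using n by simp
qed

text \<open>\<open>M\<close> is the reference law. In \<open>N\<close>, b m accounts for the m + 1
  places of the giant component and F ^ m for the other m components being at most n.\<close>

definition Y where "Y = cond_pmf X {..n}"
definition N where "N = embed_pmf (\<lambda>m. b m * F ^ m / A)"
definition M where "M = bind_pmf N (\<lambda>m. replicate_pmf m Y)"
definition T where "T = map_pmf tau (gibbs_pmf q (pmf X) n)"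

lemma pmf_Y: "pmf Y i = (if i \<le> n then pmf X i / F else 0)"
proof -
  have "n \<in> set_pmf X" using pmf_X_n by (simp add: set_pmf_iff)
  then have "set_pmf X \<inter> {..n} \<noteq> {}" by auto
  moreover have "measure_pmf.prob X {..n} = F" by (simp add: measure_measure_pmf_finite F_def)
  ultimately show ?thesis unfolding Y_def by (simp add: pmf_cond)
qed

lemma pmf_N: "pmf N m = b m * F ^ m / A"
proof -
  have "(\<Sum>m. ennreal (b m * F ^ m / A)) = ennreal (A / A)"
    using summable_A b_nonneg F_pos A_pos unfolding A_def
    by (intro suminf_ennreal_eq sums_divide summable_sums) auto
  then show ?thesis unfolding N_def using b_nonneg F_pos A_pos
    by (intro pmf_embed_pmf) (auto simp: nn_integral_count_space_nat)
qed

text \<open>The powers of F from \<open>N\<close> and from conditioning \<open>Y\<close> cancel.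
  Equality fails only for lists with an entry above n, where the left side is 0 but the right side
  need not be.\<close>

lemma pmf_M_le: "pmf M xs \<le> b (length xs) * prod_list (map (pmf X) xs) / A"
proof -
  let ?k = "length xs"
  have "pmf M xs = measure_pmf.expectation N (\<lambda>m. prod_list (map (pmf Y) xs) * indicator {?k} m)"
    unfolding M_def pmf_bind
    by (intro Bochner_Integration.integral_cong) (auto simp: pmf_replicate_pmf)
  also have "\<dots> = pmf N ?k * prod_list (map (pmf Y) xs)"
    by (simp add: measure_pmf_single)
  also have "\<dots> \<le> pmf N ?k * prod_list (map (\<lambda>i. pmf X i / F) xs)"
  proof (intro mult_left_mono)
    show "prod_list (map (pmf Y) xs) \<le> prod_list (map (\<lambda>i. pmf X i / F) xs)"
      using F_pos by (induction xs) (auto intro!: divide_right_mono mult_left_mono divide_nonneg_nonneg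
          mult_nonneg_nonneg prod_list_nonneg simp: pmf_Y)
  qed simp
  also have "prod_list (map (\<lambda>i. pmf X i / F) xs) = prod_list (map (pmf X) xs) / F ^ ?k"
    by (induction xs) auto
  also have "pmf N ?k * (prod_list (map (pmf X) xs) / F ^ ?k) = b ?k * prod_list (map (pmf X) xs) / A"
    using F_pos by (simp add: pmf_N)
  finally show ?thesis .
qed

text \<open>Adds the Gibbs weights of the k + 1 preimages, turning q(k + 1) into b k. Flatness
  compares the inserted component with n, and \<open>U_le\<close> controls the
  normalisation.\<close>

lemma pmf_T_ge:
  assumes "2 * sum_list xs < n"
  shows "(1 - 3 * \<epsilon>) * pmf M xs \<le> pmf T xs"
proof -
  define k where "k = length xs"
  define P where "P = prod_list (map (pmf X) xs)"
  define S where "S = {ks. ks \<noteq> [] \<and> tau ks = xs \<and> sum_list ks = n \<and> length ks = Suc k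
      \<and> prod_list (map (pmf X) ks) = pmf X (n - sum_list xs) * P}"
  have P: "P \<ge> 0" unfolding P_def by (intro prod_list_nonneg) auto
  have card: "Suc k \<le> card S"
    unfolding S_def P_def k_def by (rule card_tau_preimages[OF assms])
  have fin: "finite S" using card by (rule card_ge_0_finite[OF less_le_trans[OF zero_less_Suc]])
  define j where "j = n - sum_list xs"
  have j: "j \<le> n" "n \<le> 2 * j" using assms by (auto simp: j_def)
  have "(1 - \<epsilon>) * l n \<le> real j * pmf X j" using flat[OF j] by (simp add: l_def)
  also have "\<dots> \<le> real n * pmf X j" using j by (intro mult_right_mono) auto
  finally have "real n * ((1 - \<epsilon>) * pmf X n) \<le> real n * pmf X j" by (simp add: l_def mult_ac)
  then have pj: "(1 - \<epsilon>) * pmf X n \<le> pmf X j" using n by simp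
  have "(1 - 3 * \<epsilon>) * pmf M xs \<le> (1 - 3 * \<epsilon>) * (b k * P / A)"
    using eps pmf_M_le[of xs] by (intro mult_left_mono) (auto simp: k_def P_def)
  also have "\<dots> \<le> b k * P * ((1 - \<epsilon>) * pmf X n / U)"
  proof -
    have "(1 - 3 * \<epsilon>) * U \<le> (1 - 3 * \<epsilon>) * ((1 + 2 * \<epsilon>) * pmf X n * A)"
      using eps by (intro mult_left_mono U_le) auto
    also have "\<dots> = ((1 - 3 * \<epsilon>) * (1 + 2 * \<epsilon>)) * (pmf X n * A)" by simp
    \<comment> \<open>Here (1 - 3\<epsilon>)(1 + 2\<epsilon>) = 1 - \<epsilon> -
      6\<epsilon>^2.\<close>
    also have "\<dots> \<le> (1 - \<epsilon>) * (pmf X n * A)"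
      using eps A_pos by (intro mult_right_mono mult_nonneg_nonneg) (auto simp: algebra_simps)
    finally have "(1 - 3 * \<epsilon>) / A \<le> (1 - \<epsilon>) * pmf X n / U"
      using A_pos U_pos_eq by (simp add: field_simps)
    then have "b k * P * ((1 - 3 * \<epsilon>) / A) \<le> b k * P * ((1 - \<epsilon>) * pmf X n / U)"
      using b_nonneg P by (intro mult_left_mono) auto
    then show ?thesis by (simp add: mult_ac)
  qed
  also have "\<dots> \<le> b k * P * (pmf X j / U)"
    using pj U_pos_eq b_nonneg P by (intro mult_left_mono divide_right_mono) auto
  also have "\<dots> = real (Suc k) * (q (Suc k) * (pmf X j * P) / U)"
    by (simp add: b_def mult_ac)
  also have "\<dots> \<le> real (card S) * (q (Suc k) * (pmf X j * P) / U)"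
    using card q P U_pos_eq by (intro mult_right_mono) auto
  also have "\<dots> = (\<Sum>ks\<in>S. pmf (gibbs_pmf q (pmf X) n) ks)"
  proof -
    have "pmf (gibbs_pmf q (pmf X) n) ks = q (Suc k) * (pmf X j * P) / U" if "ks \<in> S" for ks
      using that pmf_gibbs_pmf[OF _ q u, of ks] by (auto simp: S_def U_def j_def)
    then show ?thesis by simp
  qed
  also have "\<dots> = measure_pmf.prob (gibbs_pmf q (pmf X) n) S"
    using fin by (simp add: measure_measure_pmf_finite)
  also have "\<dots> \<le> pmf T xs"
    unfolding T_def pmf_map by (intro measure_pmf.finite_measure_mono) (auto simp: S_def)
  finally show ?thesis .
qed

text \<open>Wald's identity: the mean length F B / A times the mean entry L / F equals L B / A,
  which \<open>drift\<close> bounds.\<close>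

lemma mean_sum_M: "(\<integral>\<^sup>+xs. ennreal (real (sum_list xs)) \<partial>M) \<le> ennreal (\<delta> * real n)"
proof -
  define L where "L = (\<Sum>i\<le>n. l i)"
  have L: "L \<ge> 0" unfolding L_def l_def by (intro sum_nonneg) auto
  have Y: "(\<integral>\<^sup>+x. ennreal (real x) \<partial>Y) = ennreal (L / F)"
  proof -
    have "set_pmf Y \<subseteq> {..n}" by (auto simp: set_pmf_iff pmf_Y split: if_splits)
    then have "(\<integral>\<^sup>+x. ennreal (real x) \<partial>Y) = (\<Sum>x\<le>n. ennreal (real x) * ennreal (pmf Y x))"
      by (intro nn_integral_measure_pmf_support) (auto simp: set_pmf_iff)
    also have "\<dots> = (\<Sum>x\<le>n. ennreal (l x / F))"
      using F_pos by (intro sum.cong) (auto simp: pmf_Y l_def simp flip: ennreal_mult)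
    also have "\<dots> = ennreal (L / F)"
      using F_pos by (subst sum_ennreal) (auto simp: L_def sum_divide_distrib l_def)
    finally show ?thesis .
  qed
  have "(\<integral>\<^sup>+xs. ennreal (real (sum_list xs)) \<partial>M) = (\<integral>\<^sup>+m. of_nat m * ennreal (L / F) \<partial>N)"
    unfolding M_def by (simp add: nn_integral_sum_list_replicate_pmf Y)
  also have "\<dots> = (\<Sum>m. ennreal (pmf N m) * (of_nat m * ennreal (L / F)))"
    by (simp add: nn_integral_measure_pmf nn_integral_count_space_nat)
  also have "\<dots> = (\<Sum>m. ennreal (L / A * (real m * b m * F ^ (m - 1))))"
  proof (rule suminf_cong)
    fix m
    have "b m * F ^ m / A * (real m * (L / F)) = L / A * (real m * b m * F ^ (m - 1))"
      using F_pos by (cases m) auto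
    then show "ennreal (pmf N m) * (of_nat m * ennreal (L / F)) = ennreal (L / A * (real m * b m * F ^ (m - 1)))"
      using F_pos L b_nonneg A_pos by (simp add: pmf_N ennreal_of_nat_eq_real_of_nat flip: ennreal_mult)
  qed
  also have "\<dots> = ennreal (L / A * B)"
    unfolding B_def using L A_pos b_nonneg F_pos
    by (intro suminf_ennreal_eq sums_mult summable_sums summable_B) auto
  also have "\<dots> \<le> ennreal (\<delta> * real n)"
    using drift A_pos by (intro ennreal_leI) (auto simp: L_def field_simps)
  finally show ?thesis .
qed

lemma prob_M_sum_ge:
  assumes "t > 0"
  shows "measure_pmf.prob M {xs. t * real n \<le> real (sum_list xs)} \<le> \<delta> / t"
  using prob_sum_list_ge_le[OF _ mean_sum_M, of "t * real n"] assms n \<delta> by simp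

lemma expectation_T_ge:
  assumes "\<And>x. 0 \<le> f x" "\<And>x. f x \<le> 1"
  shows "measure_pmf.expectation M f - 3 * \<epsilon> - 2 * \<delta> \<le> measure_pmf.expectation T f"
proof (rule expectation_lower_bound[where G = "{xs. 2 * sum_list xs < n}"])
  have "- {xs. 2 * sum_list xs < n} = {xs. 1/2 * real n \<le> real (sum_list xs)}" by auto
  then show "measure_pmf.prob M (- {xs. 2 * sum_list xs < n}) \<le> 2 * \<delta>"
    using prob_M_sum_ge[of "1/2"] by simp
qed (use assms eps pmf_T_ge in auto)

text \<open>Both laws have mass one, so the lower bound for 1 - f is an upper bound for f.\<close>

lemma expectation_T_close:
  assumes f: "\<And>x. 0 \<le> f x" "\<And>x. f x \<le> 1"
  shows "\<bar>measure_pmf.expectation T f - measure_pmf.expectation M f\<bar> \<le> 3 * \<epsilon> + 2 * \<delta>"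
proof -
  have int: "integrable (measure_pmf Q) f" for Q
    using f by (intro measure_pmf.integrable_const_bound[where B=1]) auto
  have "measure_pmf.expectation Q (\<lambda>x. 1 - f x) = 1 - measure_pmf.expectation Q f" for Q
    using int by (subst Bochner_Integration.integral_diff) auto
  then show ?thesis
    using expectation_T_ge[of f] expectation_T_ge[of "\<lambda>x. 1 - f x"] f by (auto simp: abs_le_iff)
qed

lemma prob_T_close: "\<bar>measure_pmf.prob T S - measure_pmf.prob M S\<bar> \<le> 3 * \<epsilon> + 2 * \<delta>"
  using expectation_T_close[of "indicator S"] by simp

text \<open>The kernel \<open>?R\<close> keeps the length and resamples the entries. It fixes
  \<open>M\<close> and sends \<open>T\<close> to the comparison law, so that law and
  \<open>T\<close> are both close to \<open>M\<close>.\<close>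

lemma tv_dist_tau:
  "tv_dist (map_pmf tau (gibbs_pmf q (pmf X) n)) (bind_pmf (gibbs_pmf q (pmf X) n) (\<lambda>ks. replicate_pmf (length ks - 1) (cond_pmf X {..n})))
    \<le> 6 * \<epsilon> + 4 * \<delta>"
  unfolding T_def[symmetric]
proof (rule tv_dist_le)
  fix S
  let ?R = "\<lambda>xs :: nat list. replicate_pmf (length xs) Y"
  have "bind_pmf (gibbs_pmf q (pmf X) n) (\<lambda>ks. replicate_pmf (length ks - 1) (cond_pmf X {..n})) = bind_pmf T ?R"
    by (simp add: T_def bind_map_pmf length_tau Y_def)
  moreover have "bind_pmf M ?R = M"
  proof -
    have "bind_pmf (replicate_pmf m Y) ?R = bind_pmf (replicate_pmf m Y) (\<lambda>_. replicate_pmf m Y)" for m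
      by (intro bind_pmf_cong) (auto simp: set_replicate_pmf)
    then show ?thesis by (simp add: M_def bind_assoc_pmf)
  qed
  then have "\<bar>measure_pmf.prob (bind_pmf T ?R) S - measure_pmf.prob M S\<bar> \<le> 3 * \<epsilon> + 2 * \<delta>"
    using expectation_T_close[of "\<lambda>xs. measure_pmf.prob (?R xs) S"]
    by (simp add: prob_bind_pmf[of T, symmetric] prob_bind_pmf[of M, symmetric])
  ultimately show "\<bar>measure_pmf.prob T S - measure_pmf.prob (bind_pmf (gibbs_pmf q (pmf X) n)
      (\<lambda>ks. replicate_pmf (length ks - 1) (cond_pmf X {..n}))) S\<bar> \<le> 6 * \<epsilon> + 4 * \<delta>"
    using prob_T_close[of S] by (simp add: abs_le_iff)
qed

lemma prob_tau_sum_ge: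
  assumes "t > 0"
  shows "measure_pmf.prob (gibbs_pmf q (pmf X) n) {ks. t * real n \<le> real (sum_list (tau ks))}
    \<le> \<delta> / t + 3 * \<epsilon> + 2 * \<delta>"
proof -
  let ?S = "{xs. t * real n \<le> real (sum_list xs)}"
  have "measure_pmf.prob (gibbs_pmf q (pmf X) n) {ks. t * real n \<le> real (sum_list (tau ks))} = measure_pmf.prob T ?S"
    by (simp add: T_def vimage_def)
  then show ?thesis using prob_T_close[of ?S] prob_M_sum_ge[OF assms] by (simp add: abs_le_iff)
qed

lemma AE_gibbs:
  "AE ks in gibbs_pmf q (pmf X) n. ks \<noteq> [] \<and> sum_list ks = n"
  using pmf_gibbs_pmf[OF _ q u] by (auto simp: AE_measure_pmf_iff set_pmf_iff split: if_splits)

text \<open>Almost surely n minus the largest component is the sum of the list left by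
  \<open>tau\<close>, so the deviation equals that sum divided by n.\<close>

lemma prob_largest:
  assumes "t > 0"
  shows "measure_pmf.prob (gibbs_pmf q (pmf X) n) {ks. \<bar>real (largest ks) / real n - 1\<bar> > t}
    \<le> \<delta> / t + 3 * \<epsilon> + 2 * \<delta>"
proof -
  have "measure_pmf.prob (gibbs_pmf q (pmf X) n) {ks. \<bar>real (largest ks) / real n - 1\<bar> > t}
      \<le> measure_pmf.prob (gibbs_pmf q (pmf X) n) {ks. t * real n \<le> real (sum_list (tau ks))}"
  proof (rule measure_pmf.finite_measure_mono_AE)
    show "AE ks in gibbs_pmf q (pmf X) n. ks \<in> {ks. \<bar>real (largest ks) / real n - 1\<bar> > t} \<longrightarrow>
        ks \<in> {ks. t * real n \<le> real (sum_list (tau ks))}"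
      using AE_gibbs
    proof eventually_elim
      case (elim ks)
      then have "real (largest ks) = real n - real (sum_list (tau ks))" using sum_list_tau[of ks] by simp
      then have "\<bar>real (largest ks) / real n - 1\<bar> = real (sum_list (tau ks)) / real n"
        using n by (simp add: diff_divide_distrib)
      then show ?case using n by (auto simp: less_divide_eq)
    qed
  qed simp
  then show ?thesis using prob_tau_sum_ge[OF assms] by linarith
qed

lemma prob_second_largest:
  assumes "t > 0"
  shows "measure_pmf.prob (gibbs_pmf q (pmf X) n) {ks. real (second_largest ks) / real n > t}
    \<le> \<delta> / t + 3 * \<epsilon> + 2 * \<delta>"
proof -
  have "measure_pmf.prob (gibbs_pmf q (pmf X) n) {ks. real (second_largest ks) / real n > t}
      \<le> measure_pmf.prob (gibbs_pmf q (pmf X) n) {ks. t * real n \<le> real (sum_list (tau ks))}"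
  proof (rule measure_pmf.finite_measure_mono, safe)
    fix ks assume "real (second_largest ks) / real n > t"
    then have "t * real n < real (second_largest ks)" using n by (simp add: field_simps)
    also have "\<dots> \<le> real (sum_list (tau ks))"
      unfolding second_largest_def by (simp add: largest_le_sum_list)
    finally show "t * real n \<le> real (sum_list (tau ks))" by simp
  qed simp
  then show ?thesis using prob_tau_sum_ge[OF assms] by linarith
qed

end

section \<open>From fixed n to the limit\<close>

text \<open>C comes from the convolution bound and is fixed before \<epsilon> and \<delta>; only the
  threshold for n depends on them.\<close>

lemma eventually_gibbs_stage:
  fixes X :: "nat pmf" and q :: "nat \<Rightarrow> real" and \<alpha> :: real
  assumes q: "\<And>k. k \<ge> 1 \<Longrightarrow> q k \<ge> 0"
    and slow_X: "slow_seq (\<lambda>n. real n * pmf X n)"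
    and slow_q: "slow_seq (\<lambda>k. real k powr (1 - \<alpha>) * q k)"
  shows "\<exists>C. \<forall>\<epsilon> \<delta>. 0 < \<epsilon> \<longrightarrow> 3 * \<epsilon> \<le> 1 \<longrightarrow> 0 < \<delta> \<longrightarrow> (\<forall>\<^sub>F n in sequentially.
     0 < gibbs_u q (pmf X) n \<longrightarrow> gibbs_u q (pmf X) n < \<top> \<longrightarrow> gibbs_stage X q n \<epsilon> C \<delta>)"
proof -
  define l where "l n = real n * pmf X n" for n
  define b where "b m = real (Suc m) * q (Suc m)" for m
  define F where "F n = (\<Sum>i\<le>n. pmf X i)" for n
  have b0: "b m \<ge> 0" for m using q by (simp add: b_def)
  have l: "slow_seq l" "\<And>n. l n \<ge> 0" "l 0 = 0" using slow_X by (auto simp: l_def[abs_def])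
  have b_eq: "real (Suc m) powr \<alpha> * (real (Suc m) powr (1 - \<alpha>) * q (Suc m)) = b m" for m
    by (simp add: b_def powr_add[symmetric] flip: mult.assoc)
  note b_props = regularly_varying_coeffs[OF slow_q, where \<alpha> = \<alpha>, unfolded b_eq]
  obtain C0 where C0: "\<forall>\<^sub>F j in sequentially. b (2 * j) \<le> C0 * b j \<and> b (2 * j + 1) \<le> C0 * b j"
    using b_props(2) by blast
  have "\<exists>D>0. \<forall>x. 1/2 \<le> x \<and> x < 1 \<longrightarrow> summable (\<lambda>m. real m * b m * x ^ (m - 1)) \<and>
      (\<Sum>m. real m * b m * x ^ (m - 1)) \<le> D / (1 - x) * (\<Sum>m. b m * x ^ m)"
    by (rule doubling_power_series[OF b0 b_props(1) C0]) (rule b_props(3))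
  then obtain D where "D > 0"
    and D': "\<forall>x. 1/2 \<le> x \<and> x < 1 \<longrightarrow> summable (\<lambda>m. real m * b m * x ^ (m - 1)) \<and>
      (\<Sum>m. real m * b m * x ^ (m - 1)) \<le> D / (1 - x) * (\<Sum>m. b m * x ^ m)"
    by (elim exE conjE)
  have D: "D > 0"
    "\<And>x. 1/2 \<le> x \<Longrightarrow> x < 1 \<Longrightarrow> summable (\<lambda>m. real m * b m * x ^ (m - 1))"
    "\<And>x. 1/2 \<le> x \<Longrightarrow> x < 1 \<Longrightarrow> (\<Sum>m. real m * b m * x ^ (m - 1)) \<le> D / (1 - x) * (\<Sum>m. b m * x ^ m)"
    using D'[rule_format] \<open>D > 0\<close> by simp_all
  obtain C1 where C1: "C1 > 0" "\<forall>\<^sub>F n in sequentially. (\<Sum>r\<le>n. l r) \<le> C1 * real n * l n"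
    using slow_seq_sum_le[OF l] by blast
  obtain C where C: "C > 0"
    "\<forall>\<^sub>F n in sequentially. \<forall>r\<le>n. (\<Sum>i\<le>r. l i * l (r - i)) \<le> C * real n * (l n)\<^sup>2"
    using slow_seq_convolution_le[OF l] by blast
  have sums_X: "pmf X sums 1"
  proof -
    have "(\<Sum>m. ennreal (pmf X m)) = 1"
      using nn_integral_pmf_eq_1[of X] by (simp add: nn_integral_count_space_nat)
    moreover from this have "summable (pmf X)" by (intro summable_suminf_not_top) auto
    ultimately show ?thesis by (simp add: suminf_ennreal2 sums_iff)
  qed
  have "F \<longlonglongrightarrow> 1"
    using sums_X unfolding F_def sums_def_le .
  then have F_half: "\<forall>\<^sub>F n in sequentially. 1/2 < F n" by (rule order_tendstoD(1)) simp
  show ?thesis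
  proof (intro exI allI impI)
    fix \<epsilon> \<delta> :: real assume eps: "0 < \<epsilon>" "3 * \<epsilon> \<le> 1" and \<delta>: "0 < \<delta>"
    \<comment> \<open>Since l n * B \<le> \<kappa> * D * A will hold, the two terms of the minimum
      are what \<open>second_order\<close> and \<open>drift\<close> require.\<close>
    define \<kappa> where "\<kappa> = min (\<epsilon> / (2 * C * D)) (\<delta> / (C1 * D))"
    have \<kappa>: "\<kappa> > 0" "2 * C * D * \<kappa> \<le> \<epsilon>" "C1 * D * \<kappa> \<le> \<delta>"
    proof -
      show "\<kappa> > 0" using eps \<delta> C C1 D by (simp add: \<kappa>_def)
      have "2 * C * D * \<kappa> \<le> 2 * C * D * (\<epsilon> / (2 * C * D))" "C1 * D * \<kappa> \<le> C1 * D * (\<delta> / (C1 * D))"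
        using C C1 D by (intro mult_left_mono; simp add: \<kappa>_def)+
      then show "2 * C * D * \<kappa> \<le> \<epsilon>" "C1 * D * \<kappa> \<le> \<delta>" using C C1 D by auto
    qed
    have tail: "\<forall>\<^sub>F n in sequentially. l n \<le> \<kappa> * (1 - F n)"
      using slow_seq_tail[OF _ sums_X slow_X \<kappa>(1)] by (simp add: l_def F_def)
    have "\<forall>\<^sub>F m in sequentially. \<forall>n\<in>{m..2*m}. 0 < l m \<and> 0 < l n \<and> l m \<le> (1 + \<epsilon>) * l n \<and> l n \<le> (1 + \<epsilon>) * l m"
      using l(1) eps by (simp add: slow_seq_def)
    then obtain R where R: "\<And>m n. m \<ge> R \<Longrightarrow> n \<in> {m..2*m} \<Longrightarrow>
        0 < l m \<and> 0 < l n \<and> l m \<le> (1 + \<epsilon>) * l n \<and> l n \<le> (1 + \<epsilon>) * l m"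
      unfolding eventually_sequentially by blast
    show "\<forall>\<^sub>F n in sequentially. 0 < gibbs_u q (pmf X) n \<longrightarrow> gibbs_u q (pmf X) n < \<top> \<longrightarrow>
        gibbs_stage X q n \<epsilon> C \<delta>"
      \<comment> \<open>The threshold 2 * R + 1 puts every i \<ge> n/2 in the range where flatness
        holds.\<close>
      using tail F_half C1(2) C(2) eventually_ge_at_top[of "2 * R + 1"]
    proof eventually_elim
      case (elim n)
      have ln: "l n > 0" using R[of n n] elim by auto
      \<comment> \<open>The tail bound itself forces F n < 1, because 0 < l n \<le> \<kappa> * (1 -
        F n).\<close>
      with \<kappa> elim have F1: "F n < 1" by (smt (verit) mult_nonneg_nonpos)
      define A where "A = (\<Sum>m. b m * F n ^ m)"
      define B where "B = (\<Sum>m. real m * b m * F n ^ (m - 1))"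
      have sA: "summable (\<lambda>m. b m * F n ^ m)" using b_props(3) F1 elim by auto
      have sB: "summable (\<lambda>m. real m * b m * F n ^ (m - 1))" using D(2) F1 elim by auto
      obtain k where "b k > 0" using b_props(1) by blast
      then have A: "A > 0" unfolding A_def
        using elim b0 by (intro suminf_pos2[OF sA, of k]) auto
      have B: "B \<ge> 0" unfolding B_def using b0 elim by (intro suminf_nonneg sB) auto
      have "l n * B \<le> l n * (D / (1 - F n) * A)"
        using D(3)[of "F n"] F1 elim ln unfolding A_def B_def by (intro mult_left_mono) auto
      also have "\<dots> = (l n / (1 - F n)) * (D * A)" by simp
      also have "\<dots> \<le> \<kappa> * (D * A)"
        using elim F1 D A by (intro mult_right_mono) (auto simp: divide_le_eq)
      finally have lB: "l n * B \<le> \<kappa> * (D * A)" .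
      have second: "2 * C * l n * B \<le> \<epsilon> * A"
      proof -
        have "2 * C * (l n * B) \<le> 2 * C * (\<kappa> * (D * A))" using lB C by (intro mult_left_mono) auto
        also have "\<dots> = (2 * C * D * \<kappa>) * A" by simp
        also have "\<dots> \<le> \<epsilon> * A" using \<kappa> A by (intro mult_right_mono) auto
        finally show ?thesis by (simp add: mult.assoc)
      qed
      have drift: "(\<Sum>i\<le>n. l i) * B \<le> \<delta> * real n * A"
      proof -
        have "(\<Sum>i\<le>n. l i) * B \<le> C1 * real n * l n * B" using elim B by (intro mult_right_mono) auto
        also have "\<dots> = C1 * real n * (l n * B)" by simp
        also have "\<dots> \<le> C1 * real n * (\<kappa> * (D * A))" using lB C1 by (intro mult_left_mono) auto
        also have "\<dots> = (C1 * D * \<kappa>) * (real n * A)" by simp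
        also have "\<dots> \<le> \<delta> * (real n * A)" using \<kappa> A by (intro mult_right_mono) auto
        finally show ?thesis by (simp add: mult.assoc)
      qed
      have flat: "l i \<le> (1 + \<epsilon>) * l n \<and> (1 - \<epsilon>) * l n \<le> l i" if i: "i \<le> n" "n \<le> 2 * i" for i
      proof -
        have i': "l i \<le> (1 + \<epsilon>) * l n" "l n \<le> (1 + \<epsilon>) * l i" using R[of i n] i elim by auto
        have "(1 - \<epsilon>) * l n \<le> (1 - \<epsilon>) * ((1 + \<epsilon>) * l i)" using i' eps by (intro mult_left_mono) auto
        also have "\<dots> = l i - \<epsilon> * \<epsilon> * l i" by algebra
        also have "\<dots> \<le> l i" using l(2) by simp
        finally show ?thesis using i' by simp
      qed
      show ?case
      proof (intro impI)
        assume u: "0 < gibbs_u q (pmf X) n" "gibbs_u q (pmf X) n < \<top>"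
        have pos: "0 < n" "0 \<le> C" "0 \<le> \<delta>" using elim C(1) \<delta> by auto
        have conv: "(\<Sum>i\<le>r. l i * l (r - i)) \<le> C * real n * (l n)\<^sup>2" if "r \<le> n" for r
          using elim that by blast
        note facts = pos conv q eps ln flat sA sB A second drift u
        show "gibbs_stage X q n \<epsilon> C \<delta>"
          by (rule gibbs_stage.intro; fact facts[unfolded l_def b_def A_def B_def F_def])
      qed
    qed
  qed
qed

theorem theorem1p2:
  fixes w v :: "nat \<Rightarrow> real" and \<rho> \<alpha> :: real and Lw Lv :: "real \<Rightarrow> real"
  assumes w_nonneg: "\<And>n. w n \<ge> 0"
    and v_nonneg: "\<And>k. k \<ge> 1 \<Longrightarrow> v k \<ge> 0"
    and rho_pos: "\<rho> > 0"
    and alpha: "\<alpha> > -1"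
    and Lw: "slowly_varying Lw" and Lv: "slowly_varying Lv"
    and w_asymp: "w \<sim>[at_top] (\<lambda>n. Lw (real n) * real n powr (-1) / \<rho> ^ n)"
    and W_summable: "summable (\<lambda>n. w n * \<rho> ^ n)"
    and W_pos: "(\<Sum>n. w n * \<rho> ^ n) > 0"
    and v_asymp: "v \<sim>[at_top] (\<lambda>k. Lv (real k) * real k powr (\<alpha> - 1) / (\<Sum>n. w n * \<rho> ^ n) ^ k)"
  shows
    "(\<forall>\<epsilon>>0. \<forall>\<^sub>F n in sequentially.
        0 < gibbs_u v w n \<and> gibbs_u v w n < \<top> \<longrightarrow>
        tv_dist (map_pmf tau (gibbs_pmf v w n))
                (bind_pmf (gibbs_pmf v w n)
                   (\<lambda>ks. replicate_pmf (length ks - 1) (cond_pmf (X_pmf w \<rho>) {..n}))) < \<epsilon>)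
     \<and> (\<forall>\<epsilon>>0. \<forall>\<delta>>0. \<forall>\<^sub>F n in sequentially.
        0 < gibbs_u v w n \<and> gibbs_u v w n < \<top> \<longrightarrow>
        measure_pmf.prob (gibbs_pmf v w n)
          {ks. \<bar>real (largest ks) / real n - 1\<bar> > \<epsilon>} < \<delta>)
     \<and> (\<forall>\<epsilon>>0. \<forall>\<delta>>0. \<forall>\<^sub>F n in sequentially.
        0 < gibbs_u v w n \<and> gibbs_u v w n < \<top> \<longrightarrow>
        measure_pmf.prob (gibbs_pmf v w n)
          {ks. real (second_largest ks) / real n > \<epsilon>} < \<delta>)"
proof -
  define W where "W = (\<Sum>n. w n * \<rho> ^ n)"
  define X where "X = X_pmf w \<rho>"
  define q where "q k = v k * W ^ k" for k
  have W: "W > 0" using W_pos by (simp add: W_def)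
  have pmf_X: "pmf X = (\<lambda>m. w m * \<rho> ^ m / W)"
  proof
    fix m
    have "(\<Sum>m. ennreal (w m * \<rho> ^ m / W)) = ennreal (W / W)"
      using W_summable w_nonneg rho_pos W unfolding W_def
      by (intro suminf_ennreal_eq sums_divide summable_sums) auto
    then show "pmf X m = w m * \<rho> ^ m / W"
      unfolding X_def X_pmf_def W_def[symmetric] using w_nonneg rho_pos W
      by (intro pmf_embed_pmf) (auto simp: nn_integral_count_space_nat)
  qed
  have q: "q k \<ge> 0" if "k \<ge> 1" for k using v_nonneg[OF that] W by (simp add: q_def)
  have slow_X: "slow_seq (\<lambda>n. real n * pmf X n)"
  proof (rule slow_seq_of_slowly_varying[OF Lw])
    have "(\<lambda>n. w n * (real n * \<rho> ^ n / W)) \<sim>[at_top]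
        (\<lambda>n. Lw (real n) * real n powr (-1) / \<rho> ^ n * (real n * \<rho> ^ n / W))"
      by (intro asymp_equiv_mult w_asymp asymp_equiv_refl)
    moreover have "\<forall>\<^sub>F n in at_top. Lw (real n) * real n powr (-1) / \<rho> ^ n * (real n * \<rho> ^ n / W) = 1 / W * Lw (real n)"
      using eventually_gt_at_top[of 0] by eventually_elim (use rho_pos in \<open>simp add: powr_minus field_simps\<close>)
    ultimately have "(\<lambda>n. w n * (real n * \<rho> ^ n / W)) \<sim>[at_top] (\<lambda>n. 1 / W * Lw (real n))"
      by (rule asymp_equiv_trans[OF _ asymp_equiv_refl_ev])
    then show "(\<lambda>n. real n * pmf X n) \<sim>[at_top] (\<lambda>n. 1 / W * Lw (real n))"
      by (simp add: pmf_X mult_ac)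
  qed (use W in simp)
  have slow_q: "slow_seq (\<lambda>k. real k powr (1 - \<alpha>) * q k)"
  proof (rule slow_seq_of_slowly_varying[OF Lv])
    have "(\<lambda>k. v k * (real k powr (1 - \<alpha>) * W ^ k)) \<sim>[at_top]
        (\<lambda>k. Lv (real k) * real k powr (\<alpha> - 1) / W ^ k * (real k powr (1 - \<alpha>) * W ^ k))"
      using v_asymp unfolding W_def by (intro asymp_equiv_mult asymp_equiv_refl)
    moreover have "\<forall>\<^sub>F k in at_top. Lv (real k) * real k powr (\<alpha> - 1) / W ^ k * (real k powr (1 - \<alpha>) * W ^ k) = 1 * Lv (real k)"
      using eventually_gt_at_top[of 0]
    proof eventually_elim
      case (elim k)
      have "real k powr (\<alpha> - 1) * real k powr (1 - \<alpha>) = 1"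
        using elim by (simp flip: powr_add)
      then show ?case using W by (simp add: mult_ac)
    qed
    ultimately have "(\<lambda>k. v k * (real k powr (1 - \<alpha>) * W ^ k)) \<sim>[at_top] (\<lambda>k. 1 * Lv (real k))"
      by (rule asymp_equiv_trans[OF _ asymp_equiv_refl_ev])
    then show "(\<lambda>k. real k powr (1 - \<alpha>) * q k) \<sim>[at_top] (\<lambda>k. 1 * Lv (real k))"
      by (simp add: q_def mult_ac)
  qed simp
  have tilt: "gibbs_u q (pmf X) n = ennreal (\<rho> ^ n) * gibbs_u v w n"
    "gibbs_pmf q (pmf X) n = gibbs_pmf v w n" for n
    using gibbs_tilt[OF rho_pos W, where w=w and v=v] by (simp_all add: pmf_X q_def[abs_def])
  \<comment> \<open>The tilt multiplies u(n) by a positive finite factor, so the admissible n are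
    unchanged.\<close>
  have u_iff: "0 < gibbs_u q (pmf X) n \<longleftrightarrow> 0 < gibbs_u v w n"
    "gibbs_u q (pmf X) n < \<top> \<longleftrightarrow> gibbs_u v w n < \<top>" for n
    unfolding tilt using rho_pos
    by (auto simp: ennreal_zero_less_mult_iff ennreal_mult_less_top less_top)
  from eventually_gibbs_stage[OF q slow_X slow_q, unfolded u_iff] obtain C
    where C: "\<forall>\<epsilon> \<delta>. 0 < \<epsilon> \<longrightarrow> 3 * \<epsilon> \<le> 1 \<longrightarrow> 0 < \<delta> \<longrightarrow> (\<forall>\<^sub>F n in sequentially.
      0 < gibbs_u v w n \<longrightarrow> gibbs_u v w n < \<top> \<longrightarrow> gibbs_stage X q n \<epsilon> C \<delta>)" ..
  have stage: "\<forall>\<^sub>F n in sequentially.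
      0 < gibbs_u v w n \<and> gibbs_u v w n < \<top> \<longrightarrow> gibbs_stage X q n \<epsilon> C \<delta>"
    if "0 < \<epsilon>" "3 * \<epsilon> \<le> 1" "0 < \<delta>" for \<epsilon> \<delta>
    using C[rule_format, OF that] by eventually_elim blast
  show ?thesis
  proof (intro conjI allI impI)
    fix \<epsilon> :: real assume "\<epsilon> > 0"
    \<comment> \<open>The total variation bound is 6 * e + 4 * e = 10 * e, below \<epsilon> for e
      \<le> \<epsilon> / 24.\<close>
    define e where "e = min 1 \<epsilon> / 24"
    have e: "0 < e" "3 * e \<le> 1" "6 * e + 4 * e < \<epsilon>" using \<open>\<epsilon> > 0\<close> by (auto simp: e_def min_def)
    show "\<forall>\<^sub>F n in sequentially. 0 < gibbs_u v w n \<and> gibbs_u v w n < \<top> \<longrightarrow>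
        tv_dist (map_pmf tau (gibbs_pmf v w n)) (bind_pmf (gibbs_pmf v w n)
          (\<lambda>ks. replicate_pmf (length ks - 1) (cond_pmf (X_pmf w \<rho>) {..n}))) < \<epsilon>"
      using stage[OF e(1,2,1)]
    proof eventually_elim
      case (elim n)
      show ?case
      proof
        assume "0 < gibbs_u v w n \<and> gibbs_u v w n < \<top>"
        with elim have st: "gibbs_stage X q n e C e" by blast
        note gibbs_stage.tv_dist_tau[OF st, unfolded tilt, unfolded X_def]
        also note e(3)
        finally show "tv_dist (map_pmf tau (gibbs_pmf v w n)) (bind_pmf (gibbs_pmf v w n)
          (\<lambda>ks. replicate_pmf (length ks - 1) (cond_pmf (X_pmf w \<rho>) {..n}))) < \<epsilon>" .
      qed
    qed
  next
    fix \<epsilon> \<delta> :: real assume *: "\<epsilon> > 0" "\<delta> > 0"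
    \<comment> \<open>The bound d / \<epsilon> + 3 * e + 2 * d is at most \<delta>/8 + \<delta>/4 +
      \<delta>/4; the factor min 1 \<epsilon> in d controls d / \<epsilon> and d at once.\<close>
    define e where "e = min 1 \<delta> / 12"
    define d where "d = min 1 \<epsilon> * \<delta> / 8"
    have e: "0 < e" "3 * e \<le> 1" "e \<le> \<delta> / 12" using * by (auto simp: e_def min_def)
    have d: "0 < d" "d \<le> \<epsilon> * \<delta> / 8" "d \<le> \<delta> / 8"
      using * by (auto simp: d_def mult_right_mono[of "min 1 \<epsilon>" 1 \<delta>, simplified])
    have "d / \<epsilon> \<le> \<delta> / 8" using d * by (simp add: divide_le_eq mult_ac)
    then have le: "d / \<epsilon> + 3 * e + 2 * d < \<delta>" using d e * by linarith
    show "\<forall>\<^sub>F n in sequentially. 0 < gibbs_u v w n \<and> gibbs_u v w n < \<top> \<longrightarrow>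
        measure_pmf.prob (gibbs_pmf v w n) {ks. \<bar>real (largest ks) / real n - 1\<bar> > \<epsilon>} < \<delta>"
      using stage[OF e(1,2) d(1)]
    proof eventually_elim
      case (elim n)
      show ?case
      proof
        assume "0 < gibbs_u v w n \<and> gibbs_u v w n < \<top>"
        with elim have st: "gibbs_stage X q n e C d" by blast
        note gibbs_stage.prob_largest[OF st *(1), unfolded tilt]
        also note le
        finally show "measure_pmf.prob (gibbs_pmf v w n)
          {ks. \<bar>real (largest ks) / real n - 1\<bar> > \<epsilon>} < \<delta>" .
      qed
    qed
    show "\<forall>\<^sub>F n in sequentially. 0 < gibbs_u v w n \<and> gibbs_u v w n < \<top> \<longrightarrow>
        measure_pmf.prob (gibbs_pmf v w n) {ks. real (second_largest ks) / real n > \<epsilon>} < \<delta>"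
      using stage[OF e(1,2) d(1)]
    proof eventually_elim
      case (elim n)
      show ?case
      proof
        assume "0 < gibbs_u v w n \<and> gibbs_u v w n < \<top>"
        with elim have st: "gibbs_stage X q n e C d" by blast
        note gibbs_stage.prob_second_largest[OF st *(1), unfolded tilt]
        also note le
        finally show "measure_pmf.prob (gibbs_pmf v w n)
          {ks. real (second_largest ks) / real n > \<epsilon>} < \<delta>" .
      qed
    qed
  qed
qed

end
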